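(* For all integers $m\ge 0$ and $\lambda\in\mathbb Z$, the following identities hold in $\dot{\mathbf U}$: \[ t_{\mathrm{ev}}^{(2m)}\mathbf 1_{2\lambda} = \sum_{c=0}^m \sum_{a=0}^{2m-2c} q^{2(a+c)(m-a-\lambda)-2ac-\binom{2c}{2}} \begin{bmatrix} m-c-a-\lambda\\ c\end{bmatrix}_{q^2} E^{(a)} F^{(2m-2c-a)}\mathbf 1_{2\lambda} \] \[ \qquad + \sum_{c=0}^{m-1} \sum_{a=0}^{2m-1-2c} q^{2(a+c+1)(m-a-\lambda) -2ac-a-\binom{2c+2}{2}} \begin{bmatrix} m-c-a-\lambda-1\\ c\end{bmatrix}_{q^2} E^{(a)} F^{(2m-1-2c-a)}\mathbf 1_{2\lambda}, \] \[ t_{\mathrm{ev}}^{(2m+1)}\mathbf 1_{2\lambda} = \sum_{c=0}^{m} \sum_{a=0}^{2m+1-2c} q^{2(a+c)(m-a-\lambda)-2ac+a-\binom{2c}{2}} \begin{bmatrix} m-c-a-\lambda+1\\ c\end{bmatrix}_{q^2} E^{(a)} F^{(2m+1-2c-a)}\mathbf 1_{2\lambda} \] \[ \qquad +\sum_{c=0}^m \sum_{a=0}^{2m-2c} q^{2(a+c+1)(m-a-\lambda)-2ac-\binom{2c+2}{2}+1} \begin{bmatrix} m-c-a-\lambda\\ c\end{bmatrix}_{q^2} E^{(a)} F^{(2m-2c-a)}\mathbf 1_{2\lambda}. \] In particular, $t_{\mathrm{ev}}^{(n)}\mathbf 1_{2\lambda}\in {}_{\mathcal A}\dot{\mathbf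 U}_{\mathrm{ev}}$ for all $n\in\mathbb N$, $\lambda\in\mathbb Z$.
   Context: $\mathbb N=\{0,1,2,\dots\}$, $\mathcal A=\mathbb Z[q,q^{-1}]$. $\mathbf U=\mathbf U_q(\mathfrak{sl}_2)$ is the $\mathbb Q(q)$-algebra generated by $E,F,K,K^{-1}$ with relations $KK^{-1}=K^{-1}K=1$, $EF-FE=\frac{K-K^{-1}}{q-q^{-1}}$, $KE=q^2EK$, $KF=q^{-2}FK$. For $n\in\mathbb Z$, $[n]=\frac{q^n-q^{-n}}{q-q^{-1}}$, $[n]!=[1]\cdots[n]$ for $n\ge 0$; $E^{(n)}=E^n/[n]!$, $F^{(n)}=F^n/[n]!$. For $m\in\mathbb Z$, $b\in\mathbb N$, $\begin{bmatrix} m\\ b\end{bmatrix}_{q^2}=\prod_{1\le i\le b}\frac{q^{2(m-i+1)}-q^{-2(m-i+1)}}{q^{2i}-q^{-2i}}$. In exponents, $\binom{x}{2}=x(x-1)/2$. Empty sums are $0$. Put $\check E=q^{-1}EK^{-1}$ and $t=\check E+F+K^{-1}$. The $\imath$-divided powers $t_{\mathrm{ev}}^{(n)}$ are the polynomials in $t$ determined by $t_{\mathrm{ev}}^{(0)}=1$, $t_{\mathrm{ev}}^{(1)}=t$, and, for $a\ge 0$: $t\cdot t_{\mathrm{ev}}^{(2a)}=[2a+1]\,t_{\mathrm{ev}}^{(2a+1)}$, $t\cdot t_{\mathrm{ev}}^{(2a+1)}=[2a+2]\,t_{\mathrm{ev}}^{(2a+2)}+[2a+1]\,t_{\mathrm{ev}}^{(2a)}$.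 $\dot{\mathbf U}$ is the modified quantum group: the $\mathbb Q(q)$-algebra generated by $E\mathbf 1_\lambda$, $F\mathbf 1_\lambda$ and idempotents $\mathbf 1_\lambda$ ($\lambda\in\mathbb Z$) with relations $\mathbf 1_\lambda\mathbf 1_\mu=\delta_{\lambda,\mu}\mathbf 1_\lambda$, $E\mathbf 1_\lambda=\mathbf 1_{\lambda+2}E\mathbf 1_\lambda=\mathbf 1_{\lambda+2}E$, $F\mathbf 1_\lambda=\mathbf 1_{\lambda-2}F\mathbf 1_\lambda=\mathbf 1_{\lambda-2}F$, $EF\mathbf 1_\lambda-FE\mathbf 1_\lambda=[\lambda]\mathbf 1_\lambda$. $\mathbf U$ acts naturally on $\dot{\mathbf U}$ from the left, with $K\mathbf 1_\lambda=q^\lambda\mathbf 1_\lambda$. ${}_{\mathcal A}\dot{\mathbf U}$ is the $\mathcal A$-subalgebra of $\dot{\mathbf U}$ generated by $E^{(n)}\mathbf 1_\lambda$, $F^{(n)}\mathbf 1_\lambda$, $\mathbf 1_\lambda$ ($n\ge 0$, $\lambda\in\mathbb Z$), and ${}_{\mathcal A}\dot{\mathbf U}_{\mathrm{ev}}=\bigoplus_{\lambda\in\mathbb Z}{}_{\mathcal A}\dot{\mathbf U}\,\mathbf 1_{2\lambda}$. *)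

theory Defs
  imports
    "HOL-Computational_Algebra.Fraction_Field"
    "HOL-Computational_Algebra.Polynomial"
    "HOL-Computational_Algebra.Polynomial_Factorial"
begin

type_synonym qfield = "rat poly fract"

definition q :: qfield where
  "q = Fract [:0, 1:] 1"

definition qint :: "int \<Rightarrow> qfield" where
  "qint n = (q powi n - q powi (- n)) / (q - inverse q)"

definition qfact :: "nat \<Rightarrow> qfield" where
  "qfact n = (\<Prod>i=1..n. qint (int i))"

definition qbinom2 :: "int \<Rightarrow> nat \<Rightarrow> qfield" where
  "qbinom2 m b = (\<Prod>i=1..b. (q powi (2 * (m - int i + 1)) - q powi (- 2 * (m - int i + 1)))
                            / (q powi (2 * int i) - q powi (- 2 * int i)))"

text \<open>The product of two consecutive integers is even, so the division is exact.\<close>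

definition binom_two :: "int \<Rightarrow> int" where
  "binom_two x = x * (x - 1) div 2"

text \<open>The ring \<open>\<int>[q, q\<^sup>-\<^sup>1]\<close> of integral Laurent polynomials in q, as a subset of the field.\<close>

definition laurentA :: "qfield set" where
  "laurentA = {\<Sum>k=-N..N. of_int (c k) * q powi k | (c :: int \<Rightarrow> int) (N :: int). True}"

class q_algebra = ring +
  fixes qscale :: "qfield \<Rightarrow> 'a \<Rightarrow> 'a"  (infixr "*\<^sub>q" 75)
  assumes qscale_add_right: "c *\<^sub>q (x + y) = c *\<^sub>q x + c *\<^sub>q y"
    and qscale_add_left: "(c + d) *\<^sub>q x = c *\<^sub>q x + d *\<^sub>q x"
    and qscale_qscale: "c *\<^sub>q d *\<^sub>q x = (c * d) *\<^sub>q x"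
    and qscale_one: "1 *\<^sub>q x = x"
    and qscale_mult_left: "(c *\<^sub>q x) * y = c *\<^sub>q (x * y)"
    and qscale_mult_right: "x * (c *\<^sub>q y) = c *\<^sub>q (x * y)"

datatype 'g fterm =
    Gen 'g
  | FZero
  | FAdd "'g fterm" "'g fterm"
  | FMul "'g fterm" "'g fterm"
  | FScale qfield "'g fterm"

abbreviation FSub :: "'g fterm \<Rightarrow> 'g fterm \<Rightarrow> 'g fterm" where
  "FSub s t \<equiv> FAdd s (FScale (- 1) t)"

text \<open>A type of generators in this class carries its defining relations.  The algebra it presents
  is the set of all expressions in the generators modulo the least congruence that contains the
  relations and the axioms of an associative, not necessarily unital, algebra.\<close>

class presentation =
  fixes relator :: "'a fterm \<Rightarrow> 'a fterm \<Rightarrow> bool"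

inductive pcong :: "'g::presentation fterm \<Rightarrow> 'g fterm \<Rightarrow> bool" where
  pc_relation: "relator s t \<Longrightarrow> pcong s t"
| pc_refl: "pcong s s"
| pc_sym: "pcong s t \<Longrightarrow> pcong t s"
| pc_trans: "pcong s t \<Longrightarrow> pcong t u \<Longrightarrow> pcong s u"
| pc_add_cong: "pcong s s' \<Longrightarrow> pcong t t' \<Longrightarrow> pcong (FAdd s t) (FAdd s' t')"
| pc_mul_cong: "pcong s s' \<Longrightarrow> pcong t t' \<Longrightarrow> pcong (FMul s t) (FMul s' t')"
| pc_scale_cong: "pcong s s' \<Longrightarrow> pcong (FScale c s) (FScale c s')"
| pc_add_assoc: "pcong (FAdd (FAdd s t) u) (FAdd s (FAdd t u))"
| pc_add_comm: "pcong (FAdd s t) (FAdd t s)"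
| pc_add_zero: "pcong (FAdd FZero s) s"
| pc_add_inverse: "pcong (FAdd (FScale (- 1) s) s) FZero"
| pc_mul_assoc: "pcong (FMul (FMul s t) u) (FMul s (FMul t u))"
| pc_distrib_left: "pcong (FMul s (FAdd t u)) (FAdd (FMul s t) (FMul s u))"
| pc_distrib_right: "pcong (FMul (FAdd s t) u) (FAdd (FMul s u) (FMul t u))"
| pc_scale_add_right: "pcong (FScale c (FAdd s t)) (FAdd (FScale c s) (FScale c t))"
| pc_scale_add_left: "pcong (FScale (c + d) s) (FAdd (FScale c s) (FScale d s))"
| pc_scale_scale: "pcong (FScale c (FScale d s)) (FScale (c * d) s)"
| pc_scale_one: "pcong (FScale 1 s) s"
| pc_scale_mul_left: "pcong (FMul (FScale c s) t) (FScale c (FMul s t))"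
| pc_scale_mul_right: "pcong (FMul s (FScale c t)) (FScale c (FMul s t))"

lemma equivp_pcong: "equivp (pcong :: 'g::presentation fterm \<Rightarrow> 'g fterm \<Rightarrow> bool)"
  by (intro equivpI reflpI sympI transpI) (blast intro: pcong.intros)+

quotient_type (overloaded) 'g palg = "'g::presentation fterm" / pcong
  by (rule equivp_pcong)

instantiation palg :: (presentation) q_algebra
begin

lift_definition zero_palg :: "'a palg" is FZero .

lift_definition plus_palg :: "'a palg \<Rightarrow> 'a palg \<Rightarrow> 'a palg" is FAdd
  by (rule pcong.pc_add_cong)

lift_definition times_palg :: "'a palg \<Rightarrow> 'a palg \<Rightarrow> 'a palg" is FMul
  by (rule pcong.pc_mul_cong)

lift_definition qscale_palg :: "qfield \<Rightarrow> 'a palg \<Rightarrow> 'a palg" is FScale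
  by (rule pcong.pc_scale_cong)

lift_definition uminus_palg :: "'a palg \<Rightarrow> 'a palg" is "FScale (- 1)"
  by (rule pcong.pc_scale_cong)

lift_definition minus_palg :: "'a palg \<Rightarrow> 'a palg \<Rightarrow> 'a palg" is FSub
  by (intro pcong.pc_add_cong pcong.pc_scale_cong)

instance
proof
  fix a b c :: "'a palg" and x y :: qfield
  show "a + b + c = a + (b + c)" by transfer (rule pcong.pc_add_assoc)
  show "a + b = b + a" by transfer (rule pcong.pc_add_comm)
  show "0 + a = a" by transfer (rule pcong.pc_add_zero)
  show "- a + a = 0" by transfer (rule pcong.pc_add_inverse)
  show "a - b = a + - b" by transfer (rule pcong.pc_refl)
  show "a * b * c = a * (b * c)" by transfer (rule pcong.pc_mul_assoc)
  show "(a + b) * c = a * c + b * c" by transfer (rule pcong.pc_distrib_right)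
  show "a * (b + c) = a * b + a * c" by transfer (rule pcong.pc_distrib_left)
  show "x *\<^sub>q (a + b) = x *\<^sub>q a + x *\<^sub>q b" by transfer (rule pcong.pc_scale_add_right)
  show "(x + y) *\<^sub>q a = x *\<^sub>q a + y *\<^sub>q a" by transfer (rule pcong.pc_scale_add_left)
  show "x *\<^sub>q y *\<^sub>q a = (x * y) *\<^sub>q a" by transfer (rule pcong.pc_scale_scale)
  show "1 *\<^sub>q a = a" by transfer (rule pcong.pc_scale_one)
  show "(x *\<^sub>q a) * b = x *\<^sub>q (a * b)" by transfer (rule pcong.pc_scale_mul_left)
  show "a * (x *\<^sub>q b) = x *\<^sub>q (a * b)" by transfer (rule pcong.pc_scale_mul_right)
qed

end

lift_definition pgen :: "'g::presentation \<Rightarrow> 'g palg" is Gen .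

text \<open>A unital algebra is presented by adding a generator for the unit together with the unit laws
  to the relations.\<close>

class unital_presentation = presentation +
  fixes unit_gen :: 'a
  assumes relator_unit_left: "relator (FMul (Gen unit_gen) s) s"
    and relator_unit_right: "relator (FMul s (Gen unit_gen)) s"

instantiation palg :: (unital_presentation) monoid_mult
begin

definition one_palg :: "'a palg" where
  "one_palg = pgen unit_gen"

instance
proof
  fix a :: "'a palg"
  show "1 * a = a" unfolding one_palg_def
    by transfer (rule pcong.pc_relation, rule relator_unit_left)
  show "a * 1 = a" unfolding one_palg_def
    by transfer (rule pcong.pc_relation, rule relator_unit_right)
qed

end

datatype ugen = genE | genF | genK | genKinv | genOne

inductive urel :: "ugen fterm \<Rightarrow> ugen fterm \<Rightarrow> bool" where
  "urel (FMul (Gen genK) (Gen genKinv)) (Gen genOne)"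
| "urel (FMul (Gen genKinv) (Gen genK)) (Gen genOne)"
| "urel (FSub (FMul (Gen genE) (Gen genF)) (FMul (Gen genF) (Gen genE)))
        (FScale (1 / (q - inverse q)) (FSub (Gen genK) (Gen genKinv)))"
| "urel (FMul (Gen genK) (Gen genE)) (FScale (q powi 2) (FMul (Gen genE) (Gen genK)))"
| "urel (FMul (Gen genK) (Gen genF)) (FScale (q powi (- 2)) (FMul (Gen genF) (Gen genK)))"
| "urel (FMul (Gen genOne) s) s"
| "urel (FMul s (Gen genOne)) s"

instantiation ugen :: unital_presentation
begin

definition "relator = urel"
definition "unit_gen = genOne"

instance
  by standard (auto simp: relator_ugen_def unit_gen_ugen_def intro: urel.intros)

end

type_synonym Uq = "ugen palg"

definition E :: Uq where "E = pgen genE"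
definition F :: Uq where "F = pgen genF"
definition K :: Uq where "K = pgen genK"
definition Kinv :: Uq where "Kinv = pgen genKinv"

definition Ediv :: "nat \<Rightarrow> Uq" where
  "Ediv n = inverse (qfact n) *\<^sub>q E ^ n"

definition Fdiv :: "nat \<Rightarrow> Uq" where
  "Fdiv n = inverse (qfact n) *\<^sub>q F ^ n"

definition Echeck :: Uq where
  "Echeck = inverse q *\<^sub>q (E * Kinv)"

definition tt :: Uq where
  "tt = Echeck + F + Kinv"

text \<open>The recursion for the \<open>\<imath>\<close>-divided powers, solved for the term of highest degree; lemma
  \<open>t_ev_recursion\<close> gives it in its usual form.\<close>

fun t_ev :: "nat \<Rightarrow> Uq" where
  "t_ev 0 = 1"
| "t_ev (Suc 0) = tt"
| "t_ev (Suc (Suc n)) =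
     inverse (qint (int (n + 2))) *\<^sub>q
       (if even n then tt * t_ev (Suc n) - qint (int (n + 1)) *\<^sub>q t_ev n
        else tt * t_ev (Suc n))"

text \<open>The generator \<open>genE1 \<nu>\<close> stands for \<open>E 1\<^sub>\<nu>\<close>, \<open>genF1 \<nu>\<close> for \<open>F 1\<^sub>\<nu>\<close> and \<open>genI \<nu>\<close> for
  \<open>1\<^sub>\<nu>\<close>.  The notation \<open>1\<^sub>\<mu> E\<close> is the same generator \<open>E 1\<^sub>\<nu>\<close> with \<open>\<mu> = \<nu> + 2\<close>, so that the weight
  relations say that \<open>E 1\<^sub>\<nu>\<close> is fixed by \<open>1\<^sub>\<nu>\<close> on the right and by \<open>1\<^sub>\<mu>\<close> on the left; and
  \<open>E F 1\<^sub>\<nu>\<close> is the product of \<open>E 1\<^sub>\<mu>\<close> and \<open>F 1\<^sub>\<nu>\<close> with \<open>\<mu> = \<nu> - 2\<close>.\<close>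

datatype dgen = genE1 int | genF1 int | genI int

inductive drel :: "dgen fterm \<Rightarrow> dgen fterm \<Rightarrow> bool" where
  "drel (FMul (Gen (genI \<nu>)) (Gen (genI \<mu>))) (if \<nu> = \<mu> then Gen (genI \<nu>) else FZero)"
| "drel (FMul (Gen (genI (\<nu> + 2))) (Gen (genE1 \<nu>))) (Gen (genE1 \<nu>))"
| "drel (FMul (Gen (genE1 \<nu>)) (Gen (genI \<nu>))) (Gen (genE1 \<nu>))"
| "drel (FMul (Gen (genI (\<nu> - 2))) (Gen (genF1 \<nu>))) (Gen (genF1 \<nu>))"
| "drel (FMul (Gen (genF1 \<nu>)) (Gen (genI \<nu>))) (Gen (genF1 \<nu>))"
| "drel (FSub (FMul (Gen (genE1 (\<nu> - 2))) (Gen (genF1 \<nu>)))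
              (FMul (Gen (genF1 (\<nu> + 2))) (Gen (genE1 \<nu>))))
        (FScale (qint \<nu>) (Gen (genI \<nu>)))"

instantiation dgen :: presentation
begin

definition "relator = drel"

instance ..

end

type_synonym Udot = "dgen palg"

definition E1 :: "int \<Rightarrow> Udot" where "E1 \<nu> = pgen (genE1 \<nu>)"
definition F1 :: "int \<Rightarrow> Udot" where "F1 \<nu> = pgen (genF1 \<nu>)"
definition idem :: "int \<Rightarrow> Udot" where "idem \<nu> = pgen (genI \<nu>)"

lemma pgen_dgen_rel:
  "idem \<nu> * idem \<mu> = (if \<nu> = \<mu> then idem \<nu> else 0)"
  "idem (\<nu> + 2) * E1 \<nu> = E1 \<nu>"
  "E1 \<nu> * idem \<nu> = E1 \<nu>"
  "idem (\<nu> - 2) * F1 \<nu> = F1 \<nu>"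
  "F1 \<nu> * idem \<nu> = F1 \<nu>"
  "E1 (\<nu> - 2) * F1 \<nu> - F1 (\<nu> + 2) * E1 \<nu> = qint \<nu> *\<^sub>q idem \<nu>"
proof -
  have r: "pcong s t" if "drel s t" for s t
    using that by (simp add: pcong.pc_relation relator_dgen_def)
  have "idem \<nu> * idem \<mu> = 0" if "\<nu> \<noteq> \<mu>"
    using that r[OF drel.intros(1)[of \<nu> \<mu>]] unfolding idem_def by transfer simp
  moreover have "idem \<nu> * idem \<nu> = idem \<nu>"
    using r[OF drel.intros(1)[of \<nu> \<nu>]] unfolding idem_def by transfer simp
  ultimately show "idem \<nu> * idem \<mu> = (if \<nu> = \<mu> then idem \<nu> else 0)" by auto
qed (unfold idem_def E1_def F1_def,
     (transfer, rule pcong.pc_relation, unfold relator_dgen_def, rule drel.intros)+)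

text \<open>Left action.  Every element of the modified quantum group has only finitely many nonzero left
  weight components, and a generator of the quantum group acts on each of them by the
  corresponding element of the modified quantum group (or by a scalar).\<close>

definition wts :: "Udot \<Rightarrow> int set" where
  "wts x = {\<nu>. idem \<nu> * x \<noteq> 0}"

primrec act_gen :: "ugen \<Rightarrow> Udot \<Rightarrow> Udot" where
  "act_gen genE x = (\<Sum>\<nu>\<in>wts x. E1 \<nu> * x)"
| "act_gen genF x = (\<Sum>\<nu>\<in>wts x. F1 \<nu> * x)"
| "act_gen genK x = (\<Sum>\<nu>\<in>wts x. q powi \<nu> *\<^sub>q (idem \<nu> * x))"
| "act_gen genKinv x = (\<Sum>\<nu>\<in>wts x. q powi (- \<nu>) *\<^sub>q (idem \<nu> * x))"
| "act_gen genOne x = x"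

primrec act_term :: "ugen fterm \<Rightarrow> Udot \<Rightarrow> Udot" where
  "act_term (Gen g) x = act_gen g x"
| "act_term FZero x = 0"
| "act_term (FAdd s t) x = act_term s x + act_term t x"
| "act_term (FMul s t) x = act_term s (act_term t x)"
| "act_term (FScale c s) x = c *\<^sub>q act_term s x"

lemma palg_gen_induct [case_names gen zero add mult scale]:
  fixes x :: "'g::presentation palg"
  assumes "\<And>g. P (pgen g)" "P 0" "\<And>x y. P x \<Longrightarrow> P y \<Longrightarrow> P (x + y)"
    "\<And>x y. P x \<Longrightarrow> P y \<Longrightarrow> P (x * y)" "\<And>c x. P x \<Longrightarrow> P (c *\<^sub>q x)"
  shows "P x"
proof -
  have "P (abs_palg s)" for s
  proof (induction s)
    case (Gen g)
    then show ?case using assms(1)[of g] by (simp add: pgen.abs_eq)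
  next
    case FZero
    then show ?case using assms(2) by (simp add: zero_palg_def)
  next
    case (FAdd s t)
    then show ?case using assms(3)[OF FAdd.IH] by (simp add: plus_palg.abs_eq)
  next
    case (FMul s t)
    then show ?case using assms(4)[OF FMul.IH] by (simp add: times_palg.abs_eq)
  next
    case (FScale c s)
    then show ?case using assms(5)[OF FScale.IH] by (simp add: qscale_palg.abs_eq)
  qed
  then show ?thesis by (metis Quotient_palg Quotient_abs_rep)
qed

lemma qscale_zero_right [simp]: "c *\<^sub>q (0 :: 'a::q_algebra) = 0"
  using qscale_add_right[of c "0::'a" 0] by simp

lemma qscale_zero_left [simp]: "0 *\<^sub>q (x :: 'a::q_algebra) = 0"
  using qscale_add_left[of 0 0 x] by simp

lemma qscale_minus_one: "(- 1) *\<^sub>q (x :: 'a::q_algebra) = - x"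
proof -
  have "(- 1) *\<^sub>q x + 1 *\<^sub>q x = 0" using qscale_add_left[of "- 1" 1 x] by simp
  then show ?thesis by (simp add: qscale_one eq_neg_iff_add_eq_0)
qed

lemma qscale_sum: "c *\<^sub>q (\<Sum>i\<in>S. f i) = (\<Sum>i\<in>S. c *\<^sub>q (f i :: 'a::q_algebra))"
  by (induction S rule: infinite_finite_induct) (simp_all add: qscale_add_right)

lemma qscale_commute: "c *\<^sub>q d *\<^sub>q x = d *\<^sub>q c *\<^sub>q (x :: 'a::q_algebra)"
  by (simp add: qscale_qscale mult.commute)

lemma idem_mult_idem: "idem \<nu> * (idem \<mu> * x) = (if \<nu> = \<mu> then idem \<nu> * x else 0)"
  by (simp add: mult.assoc[symmetric] pgen_dgen_rel)

lemma wts_subset: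
  assumes "finite S" "x = (\<Sum>\<nu>\<in>S. idem \<nu> * x)"
  shows "wts x \<subseteq> S"
proof
  fix \<mu> assume "\<mu> \<in> wts x"
  then have "idem \<mu> * (\<Sum>\<nu>\<in>S. idem \<nu> * x) \<noteq> 0" using assms(2) by (simp add: wts_def)
  then have "(\<Sum>\<nu>\<in>S. if \<mu> = \<nu> then idem \<mu> * x else 0) \<noteq> 0"
    by (simp add: sum_distrib_left idem_mult_idem)
  then show "\<mu> \<in> S" using assms(1) by (auto split: if_splits)
qed

lemma idem_sum_mono:
  assumes "finite S" "wts x \<subseteq> S"
  shows "(\<Sum>\<nu>\<in>S. idem \<nu> * x) = (\<Sum>\<nu>\<in>wts x. idem \<nu> * x)"
  by (rule sum.mono_neutral_right) (use assms in \<open>auto simp: wts_def\<close>)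

lemma wts_decomposition: "finite (wts x) \<and> (\<Sum>\<nu>\<in>wts x. idem \<nu> * x) = x"
proof -
  have "\<exists>S. finite S \<and> x = (\<Sum>\<nu>\<in>S. idem \<nu> * x)"
  proof (induction x rule: palg_gen_induct)
    case (gen g)
    have "\<exists>\<mu>. idem \<mu> * pgen g = pgen g"
    proof (cases g)
      case (genE1 \<nu>)
      then show ?thesis using pgen_dgen_rel(2)[of \<nu>] by (auto simp: E1_def)
    next
      case (genF1 \<nu>)
      then show ?thesis using pgen_dgen_rel(4)[of \<nu>] by (auto simp: F1_def)
    next
      case (genI \<nu>)
      then show ?thesis using pgen_dgen_rel(1)[of \<nu> \<nu>] by (auto simp: idem_def)
    qed
    then obtain \<mu> where "idem \<mu> * pgen g = pgen g" by blast
    then show ?case by (intro exI[of _ "{\<mu>}"]) simp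
  next
    case zero
    show ?case by (intro exI[of _ "{}"]) simp
  next
    case (add x y)
    then obtain S T where S: "finite S" "x = (\<Sum>\<nu>\<in>S. idem \<nu> * x)"
      and T: "finite T" "y = (\<Sum>\<nu>\<in>T. idem \<nu> * y)" by blast
    have "(\<Sum>\<nu>\<in>S \<union> T. idem \<nu> * x) = x"
      using S wts_subset[OF S] idem_sum_mono[of S x] idem_sum_mono[of "S \<union> T" x] T(1)
      by (metis finite_UnI le_supI1)
    moreover have "(\<Sum>\<nu>\<in>S \<union> T. idem \<nu> * y) = y"
      using T wts_subset[OF T] idem_sum_mono[of T y] idem_sum_mono[of "S \<union> T" y] S(1)
      by (metis finite_UnI le_supI2)
    ultimately have "x + y = (\<Sum>\<nu>\<in>S \<union> T. idem \<nu> * (x + y))"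
      by (simp add: distrib_left sum.distrib)
    then show ?case using S(1) T(1) by blast
  next
    case (mult x y)
    then obtain S where S: "finite S" "x = (\<Sum>\<nu>\<in>S. idem \<nu> * x)" by blast
    have "x * y = (\<Sum>\<nu>\<in>S. idem \<nu> * x) * y" using S(2) by simp
    also have "\<dots> = (\<Sum>\<nu>\<in>S. idem \<nu> * (x * y))" by (simp add: sum_distrib_right mult.assoc)
    finally show ?case using S(1) by blast
  next
    case (scale c x)
    then obtain S where S: "finite S" "x = (\<Sum>\<nu>\<in>S. idem \<nu> * x)" by blast
    have "c *\<^sub>q x = c *\<^sub>q (\<Sum>\<nu>\<in>S. idem \<nu> * x)" using S(2) by simp
    also have "\<dots> = (\<Sum>\<nu>\<in>S. idem \<nu> * (c *\<^sub>q x))" by (simp add: qscale_sum qscale_mult_right)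
    finally show ?case using S(1) by blast
  qed
  then obtain S where S: "finite S" "x = (\<Sum>\<nu>\<in>S. idem \<nu> * x)" by blast
  show ?thesis
    using wts_subset[OF S] S idem_sum_mono[of S x] finite_subset by metis
qed

lemma finite_wts [simp]: "finite (wts x)"
  using wts_decomposition by blast

lemma Udot_weight_induct [case_names zero add weight]:
  assumes "P 0" "\<And>x y. P x \<Longrightarrow> P y \<Longrightarrow> P (x + y)" "\<And>\<nu> x. idem \<nu> * x = x \<Longrightarrow> P x"
  shows "P x"
proof -
  have "P (idem \<nu> * x)" for \<nu> by (rule assms(3)[of \<nu>]) (simp add: idem_mult_idem)
  then have "P (\<Sum>\<nu>\<in>S. idem \<nu> * x)" for S
    by (induction S rule: infinite_finite_induct) (simp_all add: assms(1,2))
  then show ?thesis using wts_decomposition[of x] by metis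
qed

lemma weight_sum:
  fixes f :: "int \<Rightarrow> Udot"
  assumes "\<And>\<nu>. f \<nu> * idem \<nu> = f \<nu>" "finite S" "wts x \<subseteq> S"
  shows "(\<Sum>\<nu>\<in>wts x. f \<nu> * x) = (\<Sum>\<nu>\<in>S. f \<nu> * x)"
proof (rule sum.mono_neutral_left)
  show "\<forall>\<nu>\<in>S - wts x. f \<nu> * x = 0"
  proof
    fix \<nu> assume "\<nu> \<in> S - wts x"
    then have "f \<nu> * (idem \<nu> * x) = 0" by (simp add: wts_def)
    then show "f \<nu> * x = 0" by (simp add: mult.assoc[symmetric] assms(1))
  qed
qed (use assms in auto)

text \<open>The multiplier by which a generator acts on the weight space of a given weight.\<close>

primrec act_coeff :: "ugen \<Rightarrow> int \<Rightarrow> Udot" where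
  "act_coeff genE \<nu> = E1 \<nu>"
| "act_coeff genF \<nu> = F1 \<nu>"
| "act_coeff genK \<nu> = q powi \<nu> *\<^sub>q idem \<nu>"
| "act_coeff genKinv \<nu> = q powi (- \<nu>) *\<^sub>q idem \<nu>"
| "act_coeff genOne \<nu> = idem \<nu>"

lemma act_coeff_idem: "act_coeff g \<nu> * idem \<nu> = act_coeff g \<nu>"
  by (cases g) (simp_all add: pgen_dgen_rel qscale_mult_left)

lemma act_gen_eq: "act_gen g x = (\<Sum>\<nu>\<in>wts x. act_coeff g \<nu> * x)"
  by (cases g) (simp_all add: qscale_mult_left wts_decomposition)

lemma act_gen_eq_sum:
  assumes "finite S" "wts x \<subseteq> S"
  shows "act_gen g x = (\<Sum>\<nu>\<in>S. act_coeff g \<nu> * x)"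
  unfolding act_gen_eq by (rule weight_sum[OF act_coeff_idem assms])

lemma act_gen_add: "act_gen g (x + y) = act_gen g x + act_gen g y"
proof -
  have s: "wts (x + y) \<subseteq> wts x \<union> wts y" by (auto simp: wts_def distrib_left)
  show ?thesis
    using act_gen_eq_sum[of "wts x \<union> wts y" x g] act_gen_eq_sum[of "wts x \<union> wts y" y g]
      act_gen_eq_sum[OF _ s, of g]
    by (simp add: distrib_left sum.distrib)
qed

lemma act_gen_scale: "act_gen g (c *\<^sub>q x) = c *\<^sub>q act_gen g x"
proof -
  have s: "wts (c *\<^sub>q x) \<subseteq> wts x" by (auto simp: wts_def qscale_mult_right)
  show ?thesis
    using act_gen_eq_sum[OF _ s, of g] act_gen_eq_sum[of "wts x" x g]
    by (simp add: qscale_mult_right qscale_sum)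
qed

lemma act_gen_weight:
  assumes "idem \<nu> * x = x"
  shows "act_gen g x = act_coeff g \<nu> * x"
proof -
  have "wts x \<subseteq> {\<nu>}"
  proof
    fix \<mu> assume "\<mu> \<in> wts x"
    then have "idem \<mu> * (idem \<nu> * x) \<noteq> 0" by (simp add: wts_def assms)
    then show "\<mu> \<in> {\<nu>}" by (auto simp: idem_mult_idem split: if_splits)
  qed
  then show ?thesis using act_gen_eq_sum[of "{\<nu>}" x g] by simp
qed

lemma act_term_add: "act_term s (x + y) = act_term s x + act_term s y"
  by (induction s arbitrary: x y) (simp_all add: act_gen_add qscale_add_right)

lemma act_term_scale: "act_term s (c *\<^sub>q x) = c *\<^sub>q act_term s x"
  by (induction s arbitrary: x) (simp_all add: act_gen_scale qscale_add_right qscale_commute)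

lemma act_term_0 [simp]: "act_term s 0 = 0"
  using act_term_add[of s 0 0] by simp

lemma q_nonzero [simp]: "q \<noteq> 0"
  by (simp add: q_def Zero_fract_def eq_fract)

lemma E1_weight: "idem (\<nu> + 2) * (E1 \<nu> * x) = E1 \<nu> * x"
  by (simp add: mult.assoc[symmetric] pgen_dgen_rel)

lemma F1_weight: "idem (\<nu> - 2) * (F1 \<nu> * x) = F1 \<nu> * x"
  by (simp add: mult.assoc[symmetric] pgen_dgen_rel)

lemma idem_scale_weight: "idem \<nu> * x = x \<Longrightarrow> idem \<nu> * (c *\<^sub>q x) = c *\<^sub>q x"
  by (simp add: qscale_mult_right)

lemma act_term_urel_weight:
  assumes "urel s t" and x: "idem \<nu> * x = x"
  shows "act_term s x = act_term t x"
proof -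
  have K: "act_gen genK y = q powi \<mu> *\<^sub>q y" "act_gen genKinv y = q powi (- \<mu>) *\<^sub>q y"
    if "idem \<mu> * y = y" for y \<mu>
    using act_gen_weight[OF that, of genK] act_gen_weight[OF that, of genKinv]
    by (simp_all add: qscale_mult_left that)
  have Ex: "act_gen genE x = E1 \<nu> * x" and Fx: "act_gen genF x = F1 \<nu> * x"
    using act_gen_weight[OF x] by simp_all
  from assms(1) show ?thesis
  proof cases
    case 3
    have "act_gen genE (F1 \<nu> * x) = E1 (\<nu> - 2) * (F1 \<nu> * x)"
      "act_gen genF (E1 \<nu> * x) = F1 (\<nu> + 2) * (E1 \<nu> * x)"
      using act_gen_weight[OF F1_weight, of genE] act_gen_weight[OF E1_weight, of genF] by simp_all
    then have "act_term s x = (E1 (\<nu> - 2) * F1 \<nu> - F1 (\<nu> + 2) * E1 \<nu>) * x"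
      by (simp add: 3 Ex Fx qscale_minus_one left_diff_distrib mult.assoc
          del: act_gen.simps)
    also have "\<dots> = qint \<nu> *\<^sub>q x"
      by (simp add: pgen_dgen_rel(6) qscale_mult_left x)
    also have "qint \<nu> = (1 / (q - inverse q)) * (q powi \<nu> + (- 1) * q powi (- \<nu>))"
      by (simp add: qint_def)
    also have "\<dots> *\<^sub>q x = act_term t x"
      by (simp only: 3 act_term.simps K[OF x] qscale_qscale[symmetric] qscale_add_left)
    finally show ?thesis .
  next
    case 4
    have "act_term s x = q powi (\<nu> + 2) *\<^sub>q (E1 \<nu> * x)"
      by (simp add: 4 Ex K[OF E1_weight] del: act_gen.simps)
    moreover have "act_term t x = (q powi 2 * q powi \<nu>) *\<^sub>q (E1 \<nu> * x)"
      by (simp add: 4 K[OF x] act_gen_scale Ex qscale_qscale del: act_gen.simps)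
    ultimately show ?thesis by (simp add: power_int_add mult.commute)
  next
    case 5
    have "act_term s x = q powi (\<nu> - 2) *\<^sub>q (F1 \<nu> * x)"
      by (simp add: 5 Fx K[OF F1_weight] del: act_gen.simps)
    moreover have "act_term t x = (q powi (- 2) * q powi \<nu>) *\<^sub>q (F1 \<nu> * x)"
      by (simp only: 5 act_term.simps K[OF x] act_gen_scale Fx qscale_qscale)
    moreover have "q powi (\<nu> - 2) = q powi (- 2) * q powi \<nu>"
      using power_int_add[of q "- 2" \<nu>] by simp
    ultimately show ?thesis by simp
  qed (simp_all add: K[OF x] act_gen_scale qscale_qscale qscale_one power_int_minus
      del: act_gen.simps(1-4))
qed

lemma act_term_urel: "urel s t \<Longrightarrow> act_term s x = act_term t x"
  by (induction x rule: Udot_weight_induct) (auto simp: act_term_add act_term_urel_weight)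

lemma act_term_cong: "pcong s t \<Longrightarrow> act_term s x = act_term t x"
proof (induction arbitrary: x rule: pcong.induct)
  case (pc_relation s t)
  then show ?case by (simp add: relator_ugen_def act_term_urel)
qed (simp_all add: act_term_add act_term_scale qscale_add_right qscale_add_left qscale_qscale
    qscale_one qscale_minus_one ac_simps)

definition act :: "Uq \<Rightarrow> Udot \<Rightarrow> Udot"  (infixr "\<rhd>" 75) where
  "u \<rhd> x = act_term (rep_palg u) x"

lemma act_abs: "abs_palg s \<rhd> x = act_term s x"
  unfolding act_def
  by (rule act_term_cong) (metis Quotient_palg Quotient_rep_abs equivp_pcong equivp_reflp)

lemma palg_abs_cases: obtains s where "u = abs_palg s"
  by (metis Quotient_palg Quotient_abs_rep)

text \<open>This is a left module structure, given on weight vectors as expected.\<close>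

lemma act_module:
  "(u + v) \<rhd> x = u \<rhd> x + v \<rhd> x"
  "(u * v) \<rhd> x = u \<rhd> (v \<rhd> x)"
  "(c *\<^sub>q u) \<rhd> x = c *\<^sub>q (u \<rhd> x)"
  "1 \<rhd> x = x"
  "u \<rhd> (x + y) = u \<rhd> x + u \<rhd> y"
  "u \<rhd> (c *\<^sub>q x) = c *\<^sub>q (u \<rhd> x)"
proof -
  obtain s t where st: "u = abs_palg s" "v = abs_palg t" by (metis palg_abs_cases)
  show "(u + v) \<rhd> x = u \<rhd> x + v \<rhd> x" "(u * v) \<rhd> x = u \<rhd> (v \<rhd> x)"
    "(c *\<^sub>q u) \<rhd> x = c *\<^sub>q (u \<rhd> x)" "1 \<rhd> x = x"
    "u \<rhd> (x + y) = u \<rhd> x + u \<rhd> y" "u \<rhd> (c *\<^sub>q x) = c *\<^sub>q (u \<rhd> x)"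
    by (simp_all add: st plus_palg.abs_eq times_palg.abs_eq qscale_palg.abs_eq one_palg_def
        pgen.abs_eq act_abs act_term_add act_term_scale unit_gen_ugen_def)
qed

lemma act_idem:
  "E \<rhd> idem \<nu> = E1 \<nu>"
  "F \<rhd> idem \<nu> = F1 \<nu>"
  "K \<rhd> idem \<nu> = q powi \<nu> *\<^sub>q idem \<nu>"
  "Kinv \<rhd> idem \<nu> = q powi (- \<nu>) *\<^sub>q idem \<nu>"
proof -
  have "idem \<nu> * idem \<nu> = idem \<nu>" by (simp add: pgen_dgen_rel)
  from act_gen_weight[OF this] show
    "E \<rhd> idem \<nu> = E1 \<nu>"
    "F \<rhd> idem \<nu> = F1 \<nu>"
    "K \<rhd> idem \<nu> = q powi \<nu> *\<^sub>q idem \<nu>"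
    "Kinv \<rhd> idem \<nu> = q powi (- \<nu>) *\<^sub>q idem \<nu>"
    by (simp_all add: E_def F_def K_def Kinv_def pgen.abs_eq act_abs pgen_dgen_rel
        qscale_mult_left del: act_gen.simps)
qed

lemma act_mult_right: "u \<rhd> (x * y) = (u \<rhd> x) * y"
proof (induction u arbitrary: x rule: palg_gen_induct)
  case (gen g)
  have s: "wts (x * y) \<subseteq> wts x" by (auto simp: wts_def mult.assoc[symmetric])
  show ?case
    using act_gen_eq_sum[OF _ s, of g] act_gen_eq_sum[of "wts x" x g]
    by (simp add: pgen.abs_eq act_abs sum_distrib_right mult.assoc del: act_gen.simps)
next
  case zero
  have "0 \<rhd> z = 0" for z by (simp add: zero_palg_def act_abs)
  then show ?case by simp
qed (simp_all add: act_module distrib_right qscale_mult_left)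

inductive_set AUdot :: "Udot set" where
  "idem \<nu> \<in> AUdot"
| "Ediv n \<rhd> idem \<nu> \<in> AUdot"
| "Fdiv n \<rhd> idem \<nu> \<in> AUdot"
| "x \<in> AUdot \<Longrightarrow> y \<in> AUdot \<Longrightarrow> x + y \<in> AUdot"
| "x \<in> AUdot \<Longrightarrow> y \<in> AUdot \<Longrightarrow> x * y \<in> AUdot"
| "c \<in> laurentA \<Longrightarrow> x \<in> AUdot \<Longrightarrow> c *\<^sub>q x \<in> AUdot"

text \<open>The sum is direct because the \<open>idem \<nu>\<close> are orthogonal idempotents.\<close>

definition AUdot_ev :: "Udot set" where
  "AUdot_ev = {\<Sum>\<nu>\<in>S. x \<nu> * idem (2 * \<nu>) | (S :: int set) x. finite S \<and> (\<forall>\<nu>\<in>S. x \<nu> \<in> AUdot)}"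

lemma q_power_nontrivial: "n > 0 \<Longrightarrow> q ^ n \<noteq> 1"
proof -
  assume "n > 0"
  have "q ^ n = Fract ([:0, 1:] ^ n) 1"
    by (induction n) (simp_all add: q_def One_fract_def)
  moreover have "degree ([:0, 1:: rat:] ^ n) = n" by (simp add: degree_power_eq)
  then have "[:0, 1:: rat:] ^ n \<noteq> 1" using \<open>n > 0\<close> by (metis degree_1 less_irrefl)
  ultimately show ?thesis by (simp add: One_fract_def eq_fract)
qed

lemma q_powi_minus_nonzero: "n > 0 \<Longrightarrow> q powi (int n) - q powi (- int n) \<noteq> 0"
proof
  assume "n > 0" and "q powi (int n) - q powi (- int n) = 0"
  then have "q ^ n * q ^ n = 1"
    by (simp add: power_int_minus field_simps)
  then have "q ^ (n + n) = 1" by (simp add: power_add)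
  then show False using q_power_nontrivial[of "n + n"] \<open>n > 0\<close> by simp
qed

lemma qint_nonzero: "n > 0 \<Longrightarrow> qint (int n) \<noteq> 0"
  using q_powi_minus_nonzero[of n] q_powi_minus_nonzero[of 1] by (simp add: qint_def power_int_minus)

lemma t_ev_recursion:
  "tt * t_ev (2 * a) = qint (int (2 * a + 1)) *\<^sub>q t_ev (2 * a + 1)"
  "tt * t_ev (2 * a + 1) =
     qint (int (2 * a + 2)) *\<^sub>q t_ev (2 * a + 2) + qint (int (2 * a + 1)) *\<^sub>q t_ev (2 * a)"
proof -
  have c: "qint (int n) *\<^sub>q inverse (qint (int n)) *\<^sub>q x = x" if "n > 0" for n and x :: Uq
    using qint_nonzero[OF that] by (simp add: qscale_qscale qscale_one)
  have one: "qint 1 = 1"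
    using qint_nonzero[of 1] by (auto simp: qint_def power_int_minus)
  show "tt * t_ev (2 * a) = qint (int (2 * a + 1)) *\<^sub>q t_ev (2 * a + 1)"
  proof (cases a)
    case 0
    then show ?thesis by (simp add: one qscale_one)
  next
    case (Suc b)
    have "t_ev (2 * a + 1) = inverse (qint (int (2 * a + 1))) *\<^sub>q (tt * t_ev (2 * a))"
      using t_ev.simps(3)[of "2 * b + 1"] Suc by (simp add: algebra_simps del: t_ev.simps)
    then show ?thesis by (simp add: c del: t_ev.simps of_nat_add of_nat_Suc)
  qed
  have "t_ev (2 * a + 2) = inverse (qint (int (2 * a + 2))) *\<^sub>q
      (tt * t_ev (2 * a + 1) - qint (int (2 * a + 1)) *\<^sub>q t_ev (2 * a))"
    using t_ev.simps(3)[of "2 * a"] by (simp del: t_ev.simps)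
  then show "tt * t_ev (2 * a + 1) =
     qint (int (2 * a + 2)) *\<^sub>q t_ev (2 * a + 2) + qint (int (2 * a + 1)) *\<^sub>q t_ev (2 * a)"
    by (simp add: c del: t_ev.simps of_nat_add of_nat_Suc)
qed

end

theory Submission
  imports Defs
begin

text \<open>
  Fix the weight \<open>2 * l\<close>.  The elements \<open>E\<^sup>(\<^sup>a\<^sup>) F\<^sup>(\<^sup>b\<^sup>) 1\<close> are weight vectors, and left
  multiplication by \<open>t\<close> sends such an element to a combination of its neighbours: the indices
  \<open>(a + 1, b)\<close> from \<open>Echeck\<close>, \<open>(a, b + 1)\<close> and \<open>(a - 1, b)\<close> from \<open>F\<close>, the last one because \<open>F\<close> has to be
  commuted past \<open>E\<^sup>(\<^sup>a\<^sup>)\<close>, and \<open>(a, b)\<close> from \<open>K\<^sup>-\<^sup>1\<close> (lemma \<open>tt_pbw\<close>).  Both claimed formulas are one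
  expansion \<open>\<Sum> coef n l d a E\<^sup>(\<^sup>a\<^sup>) F\<^sup>(\<^sup>n\<^sup>-\<^sup>d\<^sup>-\<^sup>a\<^sup>) 1\<close>, in which the drop \<open>d\<close> of the degree is \<open>2 * c\<close> in the
  first double sum and \<open>2 * c + 1\<close> in the second.  By induction on \<open>n\<close> it suffices that these
  expansions satisfy the recursion of the \<open>\<imath>\<close>-divided powers.

  Comparing coefficients, the recursion becomes an identity in \<open>\<rat>(q)\<close> for each parity of \<open>n\<close> and of
  \<open>d\<close> (lemma \<open>coef_step\<close>).  In each of them only the three binomials \<open>[p + 1, c]\<close>, \<open>[p, c]\<close> and
  \<open>[p, c - 1]\<close> occur, for one value of \<open>p\<close>.  They are \<open>q\<close>-integer multiples of a common factor, and
  after its cancellation the identity is verified by multiplying out both sides into powers of \<open>q\<close>.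

  Integrality follows from the expansion: its coefficients are powers of \<open>q\<close> times \<open>q\<^sup>2\<close>-binomials,
  which are Laurent polynomials by the Pascal rule, also for a negative upper index, and
  \<open>E\<^sup>(\<^sup>a\<^sup>) F\<^sup>(\<^sup>b\<^sup>) 1\<close> is the product of two of the generators of the integral form.
\<close>

section \<open>Quantum integers and binomials\<close>

definition qdiff :: "int \<Rightarrow> qfield" where
  "qdiff x = q powi x - q powi (- x)"

lemma qpow_mult: "q powi x * q powi y = q powi (x + y)"
  by (simp add: power_int_add)

lemma qpow_mult_left: "q powi x * (q powi y * z) = q powi (x + y) * z"
  by (simp add: power_int_add)

lemma qdiff_nonzero: "n > 0 \<Longrightarrow> qdiff (int n) \<noteq> 0"
  using q_powi_minus_nonzero[of n] by (simp add: qdiff_def)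

lemma qdiff_even_nonzero: "qdiff (2 * int c + 2) \<noteq> 0"
  using qdiff_nonzero[of "2 * c + 2"] by (simp add: algebra_simps)

lemma qint_qdiff: "qint n = qdiff n / qdiff 1"
  by (simp add: qint_def qdiff_def power_int_minus)

lemma qint_0 [simp]: "qint 0 = 0"
  by (simp add: qint_def)

lemma qint_1: "qint 1 = 1"
  using qdiff_nonzero[of 1] by (simp add: qint_qdiff)

lemma qint_Suc_nonzero: "qint (int n + 1) \<noteq> 0"
  using qint_nonzero[of "Suc n"] by (simp add: algebra_simps)

text \<open>An identity that is homogeneous in quantum integers can be checked on the numerators \<open>qdiff\<close>
  alone.  Keeping the factor opaque prevents the expansion of \<open>q - q\<^sup>-\<^sup>1\<close> in the denominator.\<close>

lemma qint_proportional: "\<exists>g. \<forall>n. qint n = qdiff n * g"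
  by (rule exI[of _ "inverse (qdiff 1)"]) (simp add: qint_qdiff divide_inverse)

lemma qint_mult_recursion:
  "qint (x + 1) * qint (y + x) = qint x * qint (y + x - 1) + qint (y + 2 * x)"
proof -
  obtain g where g: "\<And>n. qint n = qdiff n * g" and g1: "qdiff 1 * g = 1"
    using qint_proportional qint_1 by metis
  \<comment> \<open>The factor \<open>qdiff 1 * g = 1\<close> makes every term quadratic in quantum integers.\<close>
  have "qint (x + 1) * qint (y + x) = qint x * qint (y + x - 1) + qint (y + 2 * x) * (qdiff 1 * g)"
    unfolding g unfolding qdiff_def
    by (simp only: algebra_simps qpow_mult qpow_mult_left) (simp add: algebra_simps)
  then show ?thesis by (simp add: g1)
qed

lemma qbinom2_0 [simp]: "qbinom2 p 0 = 1"
  by (simp add: qbinom2_def)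

lemma qbinom2_Suc:
  "qbinom2 p (Suc c) = qdiff (2 * (p - int c)) * (qbinom2 p c / qdiff (2 * int c + 2))"
  unfolding qbinom2_def qdiff_def
  by (simp add: prod.nat_ivl_Suc' algebra_simps)

lemma qbinom2_Suc_shift:
  "qbinom2 (p + 1) (Suc c) = qdiff (2 * p + 2) * (qbinom2 p c / qdiff (2 * int c + 2))"
proof (induction c)
  case 0
  show ?case by (simp add: qbinom2_Suc algebra_simps)
next
  case (Suc c)
  show ?case
    unfolding qbinom2_Suc[of "p + 1" "Suc c"] Suc.IH
    unfolding qbinom2_Suc[of p c] by (simp add: algebra_simps)
qed

text \<open>The three binomials that meet in a coefficient of the recursion are multiples of one element,
  which can then be treated as an indeterminate.\<close>

lemma qbinom2_common_factor:
  obtains h where "qbinom2 (p + 1) (Suc c) = qdiff (2 * p + 2) * h"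
    "qbinom2 p (Suc c) = qdiff (2 * (p - int c)) * h"
    "qbinom2 p c = qdiff (2 * int c + 2) * h"
proof (rule that)
  let ?h = "qbinom2 p c / qdiff (2 * int c + 2)"
  show "qbinom2 (p + 1) (Suc c) = qdiff (2 * p + 2) * ?h" by (rule qbinom2_Suc_shift)
  show "qbinom2 p (Suc c) = qdiff (2 * (p - int c)) * ?h" by (rule qbinom2_Suc)
  show "qbinom2 p c = qdiff (2 * int c + 2) * ?h" using qdiff_even_nonzero[of c] by simp
qed

lemma qbinom2_Pascal:
  "qbinom2 (p + 1) (Suc c) =
     q powi (2 * int c + 2) * qbinom2 p (Suc c) + q powi (- 2 * (p - int c)) * qbinom2 p c"
proof -
  obtain h where h: "qbinom2 (p + 1) (Suc c) = qdiff (2 * p + 2) * h"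
    "qbinom2 p (Suc c) = qdiff (2 * (p - int c)) * h"
    "qbinom2 p c = qdiff (2 * int c + 2) * h" by (rule qbinom2_common_factor)
  show ?thesis
    unfolding h unfolding qdiff_def
    by (simp only: algebra_simps qpow_mult qpow_mult_left) (simp add: algebra_simps)
qed

lemma qfact_Suc: "qfact (Suc n) = qint (int n + 1) * qfact n"
  unfolding qfact_def by (simp add: prod.nat_ivl_Suc' algebra_simps)

lemma inverse_qfact: "inverse (qfact n) = qint (int n + 1) * inverse (qfact (Suc n))"
  using qint_Suc_nonzero[of n] by (simp add: qfact_Suc)

section \<open>The coefficients and their recursion\<close>

lemma binom_two_even: "binom_two (2 * x) = x * (2 * x - 1)"
  by (simp add: binom_two_def)

lemma binom_two_even_plus_2: "binom_two (2 * x + 2) = (x + 1) * (2 * x + 1)"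
  using binom_two_even[of "x + 1"] by (simp add: algebra_simps)

text \<open>The coefficient of \<open>E\<^sup>(\<^sup>a\<^sup>) F\<^sup>(\<^sup>n\<^sup>-\<^sup>d\<^sup>-\<^sup>a\<^sup>) 1\<close> in the \<open>n\<close>-th \<open>\<imath>\<close>-divided power.  The index \<open>a\<close> ranges over
  the integers because the recursion refers to \<open>a - 1\<close> and \<open>a + 1\<close>.\<close>

definition coef :: "nat \<Rightarrow> int \<Rightarrow> nat \<Rightarrow> int \<Rightarrow> qfield" where
  "coef n l d a = (let m = int (n div 2); c = int (d div 2) in
     if even n then
       if even d then q powi (2 * (a + c) * (m - a - l) - 2 * a * c - binom_two (2 * c))
                      * qbinom2 (m - c - a - l) (d div 2)
       else q powi (2 * (a + c + 1) * (m - a - l) - 2 * a * c - a - binom_two (2 * c + 2))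
                      * qbinom2 (m - c - a - l - 1) (d div 2)
     else
       if even d then q powi (2 * (a + c) * (m - a - l) - 2 * a * c + a - binom_two (2 * c))
                      * qbinom2 (m - c - a - l + 1) (d div 2)
       else q powi (2 * (a + c + 1) * (m - a - l) - 2 * a * c - binom_two (2 * c + 2) + 1)
                      * qbinom2 (m - c - a - l) (d div 2))"

lemma coef_simps:
  "coef (2 * m) l (2 * c) a =
     q powi (2 * (a + int c) * (int m - a - l) - 2 * a * int c - int c * (2 * int c - 1))
       * qbinom2 (int m - int c - a - l) c"
  "coef (2 * m) l (2 * c + 1) a =
     q powi (2 * (a + int c + 1) * (int m - a - l) - 2 * a * int c - a
             - (int c + 1) * (2 * int c + 1))
       * qbinom2 (int m - int c - a - l - 1) c"
  "coef (2 * m + 1) l (2 * c) a =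
     q powi (2 * (a + int c) * (int m - a - l) - 2 * a * int c + a - int c * (2 * int c - 1))
       * qbinom2 (int m - int c - a - l + 1) c"
  "coef (2 * m + 1) l (2 * c + 1) a =
     q powi (2 * (a + int c + 1) * (int m - a - l) - 2 * a * int c
             - (int c + 1) * (2 * int c + 1) + 1)
       * qbinom2 (int m - int c - a - l) c"
  by (simp_all add: coef_def Let_def binom_two_even binom_two_even_plus_2)

text \<open>Let \<open>f a\<close> be the coefficient of \<open>E\<^sup>(\<^sup>a\<^sup>) F\<^sup>(\<^sup>b\<^sup>) 1\<close>, for all \<open>a + b\<close> of a given value.  The next three
  functions give the coefficients of its product with \<open>t\<close> in total degree \<open>k\<close>, where \<open>k\<close> is that
  value plus 1, the value itself, and that value minus 1; in the last case up to sign.  Throughout,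
  \<open>k - a\<close> is the exponent of \<open>F\<close>.\<close>

definition t_raise :: "int \<Rightarrow> int \<Rightarrow> (int \<Rightarrow> qfield) \<Rightarrow> int \<Rightarrow> qfield" where
  "t_raise l k f a = q powi (1 - 2 * l - 2 * a + 2 * (k - a)) * qint a * f (a - 1)
                     + qint (k - a) * f a"

definition t_keep :: "int \<Rightarrow> int \<Rightarrow> (int \<Rightarrow> qfield) \<Rightarrow> int \<Rightarrow> qfield" where
  "t_keep l k f a = q powi (2 * (k - a) - 2 * a - 2 * l) * f a"

definition t_lower :: "int \<Rightarrow> int \<Rightarrow> (int \<Rightarrow> qfield) \<Rightarrow> int \<Rightarrow> qfield" where
  "t_lower l k f a = qint (2 * l - 2 * (k - a) + a) * f (a + 1)"

text \<open>The factor \<open>qint 1\<close> makes all terms of the identities below linear in quantum integers.\<close>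

lemma t_keep_homogeneous: "t_keep l k f a = qint 1 * q powi (2 * (k - a) - 2 * a - 2 * l) * f a"
  by (simp add: t_keep_def qint_1)

text \<open>The following eight lemmas are the recursion, coefficient by coefficient, for the parities of
  \<open>n\<close> and \<open>d\<close> in this order.  The cases \<open>d \<le> 1\<close> stand apart because terms from smaller \<open>d\<close> are then
  missing.  In the other cases \<open>p\<close> is the upper index for which the common factor of the binomials
  exists.\<close>

lemma coef_step_even_even_0:
  assumes "k = 2 * int m + 1"
  shows "t_raise l k (coef (2 * m) l (2 * 0)) a
    = qint (2 * int m + 1) * coef (2 * m + 1) l (2 * 0) a"
proof -
  obtain g where g: "\<And>n. qint n = qdiff n * g" using qint_proportional by blast
  show ?thesis
    unfolding coef_simps t_raise_def t_keep_homogeneous qbinom2_0 g assms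
    unfolding qdiff_def
    by (simp only: algebra_simps qpow_mult qpow_mult_left of_nat_Suc) (simp add: algebra_simps)
qed

lemma coef_step_even_even_Suc:
  assumes "k = 2 * int m + 1 - 2 * int (Suc c)"
  shows "t_raise l k (coef (2 * m) l (2 * Suc c)) a + t_keep l k (coef (2 * m) l (2 * c + 1)) a
    - t_lower l k (coef (2 * m) l (2 * c)) a
    = qint (2 * int m + 1) * coef (2 * m + 1) l (2 * Suc c) a"
proof -
  define p where "p = int m - int (Suc c) - a - l"
  obtain h where h: "qbinom2 (p + 1) (Suc c) = qdiff (2 * p + 2) * h"
    "qbinom2 p (Suc c) = qdiff (2 * (p - int c)) * h"
    "qbinom2 p c = qdiff (2 * int c + 2) * h" by (rule qbinom2_common_factor)
  obtain g where g: "\<And>n. qint n = qdiff n * g" using qint_proportional by blast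
  have p: "int m - int (Suc c) - (a - 1) - l = p + 1"
    "int m - int c - a - l - 1 = p"
    "int m - int c - (a + 1) - l = p"
    by (simp_all add: p_def)
  show ?thesis
    unfolding coef_simps t_raise_def t_lower_def t_keep_homogeneous p p_def[symmetric] h g assms
    unfolding qdiff_def p_def
    by (simp only: algebra_simps qpow_mult qpow_mult_left of_nat_Suc) (simp add: algebra_simps)
qed

lemma coef_step_even_odd_0:
  assumes "k = 2 * int m"
  shows "t_raise l k (coef (2 * m) l (2 * 0 + 1)) a + t_keep l k (coef (2 * m) l (2 * 0)) a
    = qint (2 * int m + 1) * coef (2 * m + 1) l (2 * 0 + 1) a"
proof -
  obtain g where g: "\<And>n. qint n = qdiff n * g" using qint_proportional by blast
  show ?thesis
    unfolding coef_simps t_raise_def t_keep_homogeneous qbinom2_0 g assms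
    unfolding qdiff_def
    by (simp only: algebra_simps qpow_mult qpow_mult_left of_nat_Suc) (simp add: algebra_simps)
qed

lemma coef_step_even_odd_Suc:
  assumes "k = 2 * int m - 2 * int (Suc c)"
  shows "t_raise l k (coef (2 * m) l (2 * Suc c + 1)) a + t_keep l k (coef (2 * m) l (2 * Suc c)) a
    - t_lower l k (coef (2 * m) l (2 * c + 1)) a
    = qint (2 * int m + 1) * coef (2 * m + 1) l (2 * Suc c + 1) a"
proof -
  define p where "p = int m - int (Suc c) - a - l - 1"
  obtain h where h: "qbinom2 (p + 1) (Suc c) = qdiff (2 * p + 2) * h"
    "qbinom2 p (Suc c) = qdiff (2 * (p - int c)) * h"
    "qbinom2 p c = qdiff (2 * int c + 2) * h" by (rule qbinom2_common_factor)
  obtain g where g: "\<And>n. qint n = qdiff n * g" using qint_proportional by blast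
  have p: "int m - int (Suc c) - (a - 1) - l - 1 = p + 1"
    "int m - int (Suc c) - a - l = p + 1"
    "p + 1 - 1 = p"
    "int m - int c - (a + 1) - l - 1 = p"
    by (simp_all add: p_def)
  show ?thesis
    unfolding coef_simps t_raise_def t_lower_def t_keep_homogeneous p p_def[symmetric] h g assms
    unfolding qdiff_def p_def
    by (simp only: algebra_simps qpow_mult qpow_mult_left of_nat_Suc) (simp add: algebra_simps)
qed

lemma coef_step_odd_even_0:
  assumes "k = 2 * int m + 2"
  shows "t_raise l k (coef (2 * m + 1) l (2 * 0)) a
    = qint (2 * int m + 2) * coef (2 * Suc m) l (2 * 0) a"
proof -
  obtain g where g: "\<And>n. qint n = qdiff n * g" using qint_proportional by blast
  show ?thesis
    unfolding coef_simps t_raise_def t_keep_homogeneous qbinom2_0 g assms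
    unfolding qdiff_def
    by (simp only: algebra_simps qpow_mult qpow_mult_left of_nat_Suc) (simp add: algebra_simps)
qed

lemma coef_step_odd_even_Suc:
  assumes "k = 2 * int m + 2 - 2 * int (Suc c)"
  shows "t_raise l k (coef (2 * m + 1) l (2 * Suc c)) a + t_keep l k (coef (2 * m + 1) l (2 * c + 1)) a
    - t_lower l k (coef (2 * m + 1) l (2 * c)) a
    = qint (2 * int m + 2) * coef (2 * Suc m) l (2 * Suc c) a
      + qint (2 * int m + 1) * coef (2 * m) l (2 * c) a"
proof -
  define p where "p = int m - int (Suc c) - a - l + 1"
  obtain h where h: "qbinom2 (p + 1) (Suc c) = qdiff (2 * p + 2) * h"
    "qbinom2 p (Suc c) = qdiff (2 * (p - int c)) * h"
    "qbinom2 p c = qdiff (2 * int c + 2) * h" by (rule qbinom2_common_factor)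
  obtain g where g: "\<And>n. qint n = qdiff n * g" using qint_proportional by blast
  have p: "int m - int (Suc c) - (a - 1) - l + 1 = p + 1"
    "int m - int c - a - l = p"
    "int m - int c - (a + 1) - l + 1 = p"
    "int (Suc m) - int (Suc c) - a - l = p"
    by (simp_all add: p_def)
  show ?thesis
    unfolding coef_simps t_raise_def t_lower_def t_keep_homogeneous p p_def[symmetric] h g assms
    unfolding qdiff_def p_def
    by (simp only: algebra_simps qpow_mult qpow_mult_left of_nat_Suc) (simp add: algebra_simps)
qed

lemma coef_step_odd_odd_0:
  assumes "k = 2 * int m + 1"
  shows "t_raise l k (coef (2 * m + 1) l (2 * 0 + 1)) a + t_keep l k (coef (2 * m + 1) l (2 * 0)) a
    = qint (2 * int m + 2) * coef (2 * Suc m) l (2 * 0 + 1) a"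
proof -
  obtain g where g: "\<And>n. qint n = qdiff n * g" using qint_proportional by blast
  show ?thesis
    unfolding coef_simps t_raise_def t_keep_homogeneous qbinom2_0 g assms
    unfolding qdiff_def
    by (simp only: algebra_simps qpow_mult qpow_mult_left of_nat_Suc) (simp add: algebra_simps)
qed

lemma coef_step_odd_odd_Suc:
  assumes "k = 2 * int m + 1 - 2 * int (Suc c)"
  shows "t_raise l k (coef (2 * m + 1) l (2 * Suc c + 1)) a + t_keep l k (coef (2 * m + 1) l (2 * Suc c)) a
    - t_lower l k (coef (2 * m + 1) l (2 * c + 1)) a
    = qint (2 * int m + 2) * coef (2 * Suc m) l (2 * Suc c + 1) a
      + qint (2 * int m + 1) * coef (2 * m) l (2 * c + 1) a"
proof -
  define p where "p = int m - int (Suc c) - a - l"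
  obtain h where h: "qbinom2 (p + 1) (Suc c) = qdiff (2 * p + 2) * h"
    "qbinom2 p (Suc c) = qdiff (2 * (p - int c)) * h"
    "qbinom2 p c = qdiff (2 * int c + 2) * h" by (rule qbinom2_common_factor)
  obtain g where g: "\<And>n. qint n = qdiff n * g" using qint_proportional by blast
  have p: "int m - int (Suc c) - (a - 1) - l = p + 1"
    "int m - int (Suc c) - a - l + 1 = p + 1"
    "int m - int c - (a + 1) - l = p"
    "int (Suc m) - int (Suc c) - a - l - 1 = p"
    "int m - int c - a - l - 1 = p"
    by (simp_all add: p_def)
  show ?thesis
    unfolding coef_simps t_raise_def t_lower_def t_keep_homogeneous p p_def[symmetric] h g assms
    unfolding qdiff_def p_def
    by (simp only: algebra_simps qpow_mult qpow_mult_left of_nat_Suc) (simp add: algebra_simps)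
qed

text \<open>On the right stand the coefficients of \<open>[n + 1]\<close> times the next \<open>\<imath>\<close>-divided power and, for odd
  \<open>n\<close>, of \<open>[n]\<close> times the previous one.  A monomial of drop \<open>d\<close> in the former has drop \<open>d - 2\<close> in the
  latter.\<close>

lemma coef_step:
  assumes k: "k = int n + 1 - int d"
  shows "t_raise l k (coef n l d) a
    + (if 1 \<le> d then t_keep l k (coef n l (d - 1)) a else 0)
    - (if 2 \<le> d then t_lower l k (coef n l (d - 2)) a else 0)
    = qint (int n + 1) * coef (Suc n) l d a
      + (if odd n \<and> 2 \<le> d then qint (int n) * coef (n - 1) l (d - 2) a else 0)"
proof -
  have "n = 2 * (n div 2) \<or> n = 2 * (n div 2) + 1" and "d = 2 * (d div 2) \<or> d = 2 * (d div 2) + 1"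
    by presburger+
  then obtain m c where n: "n = 2 * m \<or> n = 2 * m + 1" and d: "d = 2 * c \<or> d = 2 * c + 1" by metis
  show ?thesis
  proof (cases c)
    case 0
    then show ?thesis
      using n d k coef_step_even_even_0[of k m l a] coef_step_even_odd_0[of k m l a]
        coef_step_odd_even_0[of k m l a] coef_step_odd_odd_0[of k m l a]
      by (auto simp: algebra_simps)
  next
    case (Suc e)
    then show ?thesis
      using n d k coef_step_even_even_Suc[of k m e l a] coef_step_even_odd_Suc[of k m e l a]
        coef_step_odd_even_Suc[of k m e l a] coef_step_odd_odd_Suc[of k m e l a]
      by (elim disjE) (simp_all add: algebra_simps)
  qed
qed

section \<open>The action of \<open>t\<close> on divided power monomials\<close>

lemma qscale_minus_right: "c *\<^sub>q (y - z) = c *\<^sub>q y - c *\<^sub>q (z :: 'a :: q_algebra)"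
  using qscale_add_right[of c "y - z" z] by (simp add: algebra_simps)

lemma qscale_minus_left: "(c - d) *\<^sub>q y = c *\<^sub>q y - d *\<^sub>q (y :: 'a :: q_algebra)"
  using qscale_add_left[of "c - d" d y] by (simp add: algebra_simps)

lemma act_0 [simp]: "u \<rhd> 0 = 0"
  using act_module(6)[of u 0 0] by simp

lemma act_sum: "u \<rhd> (\<Sum>i\<in>S. f i) = (\<Sum>i\<in>S. u \<rhd> f i)"
  by (induction S rule: infinite_finite_induct) (simp_all add: act_module)

lemma act_minus_right: "u \<rhd> (x - y) = u \<rhd> x - u \<rhd> y"
  using act_module(5)[of u "x - y" y] by (simp add: algebra_simps)

lemma act_minus: "(u - v) \<rhd> x = u \<rhd> x - v \<rhd> x"
  using act_module(1)[of "u - v" v x] by (simp add: algebra_simps)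

lemma act_weight:
  assumes "idem \<nu> * x = x"
  shows "E \<rhd> x = E1 \<nu> * x" "F \<rhd> x = F1 \<nu> * x" "Kinv \<rhd> x = q powi (- \<nu>) *\<^sub>q x"
    "idem (\<nu> + 2) * (E \<rhd> x) = E \<rhd> x" "idem (\<nu> - 2) * (F \<rhd> x) = F \<rhd> x"
proof -
  have "u \<rhd> x = (u \<rhd> idem \<nu>) * x" for u
    using act_mult_right[of u "idem \<nu>" x] assms by simp
  from this[of E] this[of F] this[of Kinv]
  show "E \<rhd> x = E1 \<nu> * x" "F \<rhd> x = F1 \<nu> * x" "Kinv \<rhd> x = q powi (- \<nu>) *\<^sub>q x"
    "idem (\<nu> + 2) * (E \<rhd> x) = E \<rhd> x" "idem (\<nu> - 2) * (F \<rhd> x) = F \<rhd> x"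
    by (simp_all add: act_idem qscale_mult_left assms E1_weight F1_weight)
qed

text \<open>The defining relation, moved from the idempotents to arbitrary weight vectors.\<close>

lemma E_F_commutator_weight:
  assumes x: "idem \<nu> * x = x"
  shows "F \<rhd> E \<rhd> x = E \<rhd> F \<rhd> x - qint \<nu> *\<^sub>q x"
proof -
  have "E \<rhd> F \<rhd> x - F \<rhd> E \<rhd> x = (E1 (\<nu> - 2) * F1 \<nu> - F1 (\<nu> + 2) * E1 \<nu>) * x"
    using act_weight(1)[OF act_weight(5)[OF x]] act_weight(2)[OF act_weight(4)[OF x]]
    by (simp add: act_weight(1,2)[OF x] left_diff_distrib mult.assoc)
  also have "\<dots> = qint \<nu> *\<^sub>q x" by (simp add: pgen_dgen_rel(6) qscale_mult_left x)
  finally show ?thesis by (simp add: algebra_simps)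
qed

lemma E_power_weight: "idem \<nu> * x = x \<Longrightarrow> idem (\<nu> + 2 * int a) * (E ^ a \<rhd> x) = E ^ a \<rhd> x"
proof (induction a)
  case (Suc a)
  then show ?case using act_weight(4)[of "\<nu> + 2 * int a" "E ^ a \<rhd> x"]
    by (simp add: act_module algebra_simps)
qed (simp add: act_module)

lemma F_power_weight: "idem \<nu> * x = x \<Longrightarrow> idem (\<nu> - 2 * int b) * (F ^ b \<rhd> x) = F ^ b \<rhd> x"
proof (induction b)
  case (Suc a)
  then show ?case using act_weight(5)[of "\<nu> - 2 * int a" "F ^ a \<rhd> x"]
    by (simp add: act_module algebra_simps)
qed (simp add: act_module)

text \<open>Moving \<open>F\<close> past one further \<open>E\<close>, applied to a vector of weight \<open>\<nu> + 2 * a\<close>, costs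
  \<open>[\<nu> + 2 * a]\<close>.  These costs add up by \<open>qint_mult_recursion\<close>.  For \<open>a = 0\<close> the factor
  \<open>[0]\<close> removes the term with the truncated exponent \<open>a - 1\<close>.\<close>

lemma F_E_power:
  assumes x: "idem \<nu> * x = x"
  shows "F \<rhd> E ^ a \<rhd> x = E ^ a \<rhd> F \<rhd> x - (qint (int a) * qint (\<nu> + int a - 1)) *\<^sub>q (E ^ (a - 1) \<rhd> x)"
proof (induction a)
  case 0
  show ?case by (simp add: act_module)
next
  case (Suc a)
  have "(qint (int a) * qint (\<nu> + int a - 1)) *\<^sub>q (E \<rhd> E ^ (a - 1) \<rhd> x)
      = (qint (int a) * qint (\<nu> + int a - 1)) *\<^sub>q (E ^ a \<rhd> x)"
    by (cases a) (simp_all add: act_module)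
  then have "F \<rhd> E ^ Suc a \<rhd> x = E ^ Suc a \<rhd> F \<rhd> x
      - ((qint (int a) * qint (\<nu> + int a - 1)) *\<^sub>q (E ^ a \<rhd> x) + qint (\<nu> + 2 * int a) *\<^sub>q (E ^ a \<rhd> x))"
    using E_F_commutator_weight[OF E_power_weight[OF x, of a]] Suc.IH
    by (simp add: act_module act_minus_right)
  also have "(qint (int a) * qint (\<nu> + int a - 1)) *\<^sub>q (E ^ a \<rhd> x) + qint (\<nu> + 2 * int a) *\<^sub>q (E ^ a \<rhd> x)
      = (qint (int a + 1) * qint (\<nu> + int a)) *\<^sub>q (E ^ a \<rhd> x)"
    by (simp add: qint_mult_recursion qscale_add_left)
  finally show ?case by (simp add: add.commute)
qed

lemma E_Ediv: "E \<rhd> Ediv a \<rhd> x = qint (int a + 1) *\<^sub>q (Ediv (Suc a) \<rhd> x)"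
  unfolding Ediv_def by (subst inverse_qfact) (simp add: act_module qscale_qscale)

lemma F_Fdiv: "F \<rhd> Fdiv b \<rhd> x = qint (int b + 1) *\<^sub>q (Fdiv (Suc b) \<rhd> x)"
  unfolding Fdiv_def by (subst inverse_qfact) (simp add: act_module qscale_qscale)

lemma F_Ediv:
  assumes "idem \<nu> * x = x"
  shows "F \<rhd> Ediv a \<rhd> x = Ediv a \<rhd> F \<rhd> x
     - (if a = 0 then 0 else qint (\<nu> + int a - 1) *\<^sub>q (Ediv (a - 1) \<rhd> x))"
proof (cases a)
  case 0
  then show ?thesis by (simp add: Ediv_def act_module)
next
  case (Suc k)
  show ?thesis
    unfolding Ediv_def using F_E_power[OF assms, of a] inverse_qfact[of k] Suc
    by (simp add: act_module qscale_minus_right qscale_qscale mult_ac add_ac)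
qed

lemma Ediv_weight: "idem \<nu> * x = x \<Longrightarrow> idem (\<nu> + 2 * int a) * (Ediv a \<rhd> x) = Ediv a \<rhd> x"
  using E_power_weight[of \<nu> x a] by (simp add: Ediv_def act_module idem_scale_weight)

lemma Fdiv_weight: "idem \<nu> * x = x \<Longrightarrow> idem (\<nu> - 2 * int b) * (Fdiv b \<rhd> x) = Fdiv b \<rhd> x"
  using F_power_weight[of \<nu> x b] by (simp add: Fdiv_def act_module idem_scale_weight)

definition pbw :: "int \<Rightarrow> nat \<Rightarrow> nat \<Rightarrow> Udot" where
  "pbw l a b = (Ediv a * Fdiv b) \<rhd> idem (2 * l)"

text \<open>\<open>Kinv\<close> and hence \<open>Echeck\<close> see the weight \<open>2 * l + 2 * a - 2 * b\<close> of the monomial.  The vector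
  past which \<open>F\<close> is commuted is \<open>F\<^sup>(\<^sup>b\<^sup>) 1\<close>, of weight \<open>2 * l - 2 * b\<close>.\<close>

lemma tt_pbw:
  "tt \<rhd> pbw l a b =
     (q powi (2 * int b - 2 * int a - 2 * l - 1) * qint (int a + 1)) *\<^sub>q pbw l (Suc a) b
   + qint (int b + 1) *\<^sub>q pbw l a (Suc b)
   + q powi (2 * int b - 2 * int a - 2 * l) *\<^sub>q pbw l a b
   - (if a = 0 then 0 else qint (2 * l - 2 * int b + int a - 1) *\<^sub>q pbw l (a - 1) b)"
proof -
  have w: "idem (2 * l) * idem (2 * l) = idem (2 * l)" by (simp add: pgen_dgen_rel)
  note wF = Fdiv_weight[OF w, of b]
  note wE = Ediv_weight[OF wF, of a]
  have K: "Kinv \<rhd> pbw l a b = q powi (2 * int b - 2 * int a - 2 * l) *\<^sub>q pbw l a b"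
    using act_weight(3)[OF wE] by (simp add: pbw_def act_module algebra_simps)
  have "E \<rhd> pbw l a b = qint (int a + 1) *\<^sub>q pbw l (Suc a) b"
    by (simp add: pbw_def act_module E_Ediv)
  then have Ech: "Echeck \<rhd> pbw l a b
      = (q powi (2 * int b - 2 * int a - 2 * l - 1) * qint (int a + 1)) *\<^sub>q pbw l (Suc a) b"
    by (simp add: Echeck_def act_module K qscale_qscale power_int_diff divide_inverse mult_ac)
  have F: "F \<rhd> pbw l a b = qint (int b + 1) *\<^sub>q pbw l a (Suc b)
     - (if a = 0 then 0 else qint (2 * l - 2 * int b + int a - 1) *\<^sub>q pbw l (a - 1) b)"
    by (simp add: pbw_def act_module F_Ediv[OF wF] F_Fdiv)
  show ?thesis by (simp add: tt_def act_module K Ech F)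
qed

section \<open>The expansion of the \<open>\<imath>\<close>-divided powers\<close>

definition homog :: "int \<Rightarrow> nat \<Rightarrow> (int \<Rightarrow> qfield) \<Rightarrow> Udot" where
  "homog l k f = (\<Sum>a\<le>k. f (int a) *\<^sub>q pbw l a (k - a))"

lemma homog_add: "homog l k (\<lambda>a. f a + g a) = homog l k f + homog l k g"
  by (simp add: homog_def qscale_add_left sum.distrib)

lemma homog_minus: "homog l k (\<lambda>a. f a - g a) = homog l k f - homog l k g"
  by (simp add: homog_def qscale_minus_left sum_subtractf)

lemma homog_scale: "homog l k (\<lambda>a. c * f a) = c *\<^sub>q homog l k f"
  by (simp add: homog_def qscale_sum qscale_qscale)

lemma homog_zero: "homog l k (\<lambda>a. 0) = 0"
  by (simp add: homog_def)

text \<open>Although \<open>f\<close> need not vanish outside \<open>0, \<dots>, k\<close>, no boundary terms arise, because \<open>t_raise\<close>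
  multiplies \<open>f (- 1)\<close> and \<open>f (k + 1)\<close> by \<open>[0]\<close>.\<close>

lemma tt_homog:
  "tt \<rhd> homog l k f = homog l (Suc k) (t_raise l (int (Suc k)) f) + homog l k (t_keep l (int k) f)
     - (if k = 0 then 0 else homog l (k - 1) (t_lower l (int (k - 1)) f))"
proof -
  have 1: "tt \<rhd> homog l k f =
      (\<Sum>a\<le>k. (q powi (2 * int (k - a) - 2 * int a - 2 * l - 1) * qint (int a + 1) * f (int a))
          *\<^sub>q pbw l (Suc a) (k - a))
    + (\<Sum>a\<le>k. (qint (int (k - a) + 1) * f (int a)) *\<^sub>q pbw l a (Suc (k - a)))
    + (\<Sum>a\<le>k. (q powi (2 * int (k - a) - 2 * int a - 2 * l) * f (int a)) *\<^sub>q pbw l a (k - a))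
    - (\<Sum>a\<le>k. if a = 0 then 0 else (qint (2 * l - 2 * int (k - a) + int a - 1)
        * f (int a)) *\<^sub>q pbw l (a - 1) (k - a))"
    unfolding homog_def act_sum act_module tt_pbw qscale_add_right qscale_minus_right
      sum.distrib sum_subtractf qscale_qscale
    by (simp add: mult_ac qscale_qscale if_distrib cong: if_cong)
  \<comment> \<open>The contributions of \<open>Echeck\<close>, of \<open>F\<close> as it raises the exponent of \<open>F\<close>, of \<open>Kinv\<close>, and of \<open>F\<close> as
    it lowers the exponent of \<open>E\<close>, reindexed by the monomials that they produce.\<close>
  have E: "(\<Sum>a\<le>k. (q powi (2 * int (k - a) - 2 * int a - 2 * l - 1) * qint (int a + 1) * f (int a))
        *\<^sub>q pbw l (Suc a) (k - a))
    = (\<Sum>a\<le>Suc k. (q powi (1 - 2 * l - 2 * int a + 2 * (int (Suc k) - int a)) * qint (int a)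
        * f (int a - 1)) *\<^sub>q pbw l a (Suc k - a))"
    unfolding sum.atMost_Suc_shift
    by (simp add: of_nat_diff algebra_simps)
  have Fp: "(\<Sum>a\<le>k. (qint (int (k - a) + 1) * f (int a)) *\<^sub>q pbw l a (Suc (k - a)))
    = (\<Sum>a\<le>Suc k. (qint (int (Suc k) - int a) * f (int a)) *\<^sub>q pbw l a (Suc k - a))"
    by (simp add: of_nat_diff algebra_simps Suc_diff_le)
  have M: "(\<Sum>a\<le>k. (q powi (2 * int (k - a) - 2 * int a - 2 * l) * f (int a)) *\<^sub>q pbw l a (k - a))
     = homog l k (t_keep l (int k) f)"
    unfolding homog_def t_keep_def by (simp add: of_nat_diff)
  have D: "(\<Sum>a\<le>k. if a = 0 then 0 else (qint (2 * l - 2 * int (k - a) + int a - 1)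
        * f (int a)) *\<^sub>q pbw l (a - 1) (k - a))
     = (if k = 0 then 0 else homog l (k - 1) (t_lower l (int (k - 1)) f))"
  proof (cases k)
    case (Suc j)
    then show ?thesis
      unfolding homog_def t_lower_def
      by (simp only: sum.atMost_Suc_shift) (simp add: of_nat_diff algebra_simps)
  qed simp
  have U: "homog l (Suc k) (t_raise l (int (Suc k)) f) =
     (\<Sum>a\<le>Suc k. (q powi (1 - 2 * l - 2 * int a + 2 * (int (Suc k) - int a)) * qint (int a)
        * f (int a - 1)) *\<^sub>q pbw l a (Suc k - a))
   + (\<Sum>a\<le>Suc k. (qint (int (Suc k) - int a) * f (int a)) *\<^sub>q pbw l a (Suc k - a))"
    unfolding homog_def t_raise_def qscale_add_left sum.distrib ..
  show ?thesis unfolding 1 E Fp M D U ..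
qed

lemma sum_shift_1: "(\<Sum>d\<le>Suc n. if 1 \<le> d then f (d - 1) else 0) = (\<Sum>d\<le>n. f d :: 'a :: comm_monoid_add)"
  by (simp only: sum.atMost_Suc_shift) simp

lemma sum_shift_2: "(\<Sum>d\<le>Suc n. if 2 \<le> d then f (d - 2) else 0) = (\<Sum>d<n. f d :: 'a :: comm_monoid_add)"
proof (cases n)
  case (Suc k)
  then show ?thesis by (simp only: sum.atMost_Suc_shift lessThan_Suc_atMost) simp
qed simp

definition expansion :: "nat \<Rightarrow> int \<Rightarrow> Udot" where
  "expansion n l = (\<Sum>d\<le>n. homog l (n - d) (coef n l d))"

text \<open>The recursion of the \<open>\<imath>\<close>-divided powers for the expansions.  All contributions to degree
  \<open>n + 1 - d\<close> are collected: they are raised from drop \<open>d\<close>, kept from drop \<open>d - 1\<close> and lowered from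
  drop \<open>d - 2\<close>.  Raising vanishes in degree 0, which covers \<open>d = n + 1\<close>.\<close>

lemma tt_expansion:
  "tt \<rhd> expansion n l = qint (int n + 1) *\<^sub>q expansion (Suc n) l
     + (if odd n then qint (int n) *\<^sub>q expansion (n - 1) l else 0)"
proof -
  let ?k = "\<lambda>d. Suc n - d"
  have homog_cong: "homog l k f = homog l k g" if "\<And>a. f a = g a" for k f g
    using that by (simp add: homog_def)
  have raise_0: "homog l 0 (t_raise l 0 f) = 0" for f
    by (simp add: homog_def t_raise_def)
  have "tt \<rhd> expansion n l = (\<Sum>d\<le>n. homog l (Suc (n - d)) (t_raise l (int (Suc (n - d))) (coef n l d)))
      + (\<Sum>d\<le>n. homog l (n - d) (t_keep l (int (n - d)) (coef n l d)))
      - (\<Sum>d\<le>n. if n - d = 0 then 0 else homog l (n - d - 1) (t_lower l (int (n - d - 1)) (coef n l d)))"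
    by (simp add: expansion_def act_sum tt_homog sum.distrib sum_subtractf)
  also have "(\<Sum>d\<le>n. homog l (Suc (n - d)) (t_raise l (int (Suc (n - d))) (coef n l d)))
      = (\<Sum>d\<le>Suc n. homog l (?k d) (t_raise l (int (?k d)) (coef n l d)))"
    by (auto simp: raise_0 Suc_diff_le simp del: of_nat_Suc of_nat_diff intro!: sum.cong)
  also have "(\<Sum>d\<le>n. homog l (n - d) (t_keep l (int (n - d)) (coef n l d)))
      = (\<Sum>d\<le>Suc n. if 1 \<le> d then homog l (?k d) (t_keep l (int (?k d)) (coef n l (d - 1))) else 0)"
    by (rule trans[OF sum_shift_1[symmetric]], rule sum.cong) (auto simp: Suc_diff_le)
  also have "(\<Sum>d\<le>n. if n - d = 0 then 0 else homog l (n - d - 1) (t_lower l (int (n - d - 1)) (coef n l d)))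
      = (\<Sum>d<n. homog l (n - d - 1) (t_lower l (int (n - d - 1)) (coef n l d)))"
    by (simp only: lessThan_Suc_atMost[symmetric] sum.lessThan_Suc) (auto intro: sum.cong)
  also have "\<dots> = (\<Sum>d\<le>Suc n. if 2 \<le> d then homog l (?k d) (t_lower l (int (?k d)) (coef n l (d - 2))) else 0)"
    by (rule trans[OF sum_shift_2[symmetric]], rule sum.cong) (auto simp: numeral_2_eq_2)
  also have "(\<Sum>d\<le>Suc n. homog l (?k d) (t_raise l (int (?k d)) (coef n l d)))
      + (\<Sum>d\<le>Suc n. if 1 \<le> d then homog l (?k d) (t_keep l (int (?k d)) (coef n l (d - 1))) else 0)
      - (\<Sum>d\<le>Suc n. if 2 \<le> d then homog l (?k d) (t_lower l (int (?k d)) (coef n l (d - 2))) else 0)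
    = (\<Sum>d\<le>Suc n. homog l (?k d) (\<lambda>a. t_raise l (int (?k d)) (coef n l d) a
         + (if 1 \<le> d then t_keep l (int (?k d)) (coef n l (d - 1)) a else 0)
         - (if 2 \<le> d then t_lower l (int (?k d)) (coef n l (d - 2)) a else 0)))"
    unfolding sum.distrib[symmetric] sum_subtractf[symmetric] homog_add homog_minus
    by (intro sum.cong) (auto simp: homog_zero)
  also have "\<dots> = (\<Sum>d\<le>Suc n. homog l (?k d) (\<lambda>a. qint (int n + 1) * coef (Suc n) l d a
      + (if odd n \<and> 2 \<le> d then qint (int n) * coef (n - 1) l (d - 2) a else 0)))"
    by (intro sum.cong homog_cong coef_step refl) auto
  also have "\<dots> = qint (int n + 1) *\<^sub>q expansion (Suc n) l
      + (\<Sum>d\<le>Suc n. if 2 \<le> d then (if odd n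
          then qint (int n) *\<^sub>q homog l (n - 1 - (d - 2)) (coef (n - 1) l (d - 2)) else 0) else 0)"
    unfolding homog_add sum.distrib homog_scale expansion_def qscale_sum
    by (intro arg_cong2[where f = "(+)"] sum.cong) (auto simp: homog_zero homog_scale numeral_2_eq_2)
  also have "(\<Sum>d\<le>Suc n. if 2 \<le> d then (if odd n
          then qint (int n) *\<^sub>q homog l (n - 1 - (d - 2)) (coef (n - 1) l (d - 2)) else 0) else 0)
      = (if odd n then qint (int n) *\<^sub>q expansion (n - 1) l else 0)"
    by (rule trans[OF sum_shift_2[where f = "\<lambda>d. if odd n then qint (int n) *\<^sub>q
            homog l (n - 1 - d) (coef (n - 1) l d) else 0"]], cases n)
       (auto simp: expansion_def qscale_sum lessThan_Suc_atMost)
  finally show ?thesis .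
qed

lemma pbw_0_0: "pbw l 0 0 = idem (2 * l)"
proof -
  have "qfact 0 = 1" by (simp add: qfact_def)
  then show ?thesis by (simp add: pbw_def Ediv_def Fdiv_def act_module qscale_one)
qed

lemma t_ev_expansion: "t_ev n \<rhd> idem (2 * l) = expansion n l"
proof (induction n rule: t_ev.induct)
  case 1
  show ?case
    using coef_simps(1)[of 0 l 0 0] by (simp add: expansion_def homog_def pbw_0_0 act_module qscale_one)
next
  case 2
  show ?case
    using tt_expansion[of 0 l] coef_simps(1)[of 0 l 0 0]
    by (simp add: expansion_def[of 0] homog_def pbw_0_0 qscale_one qint_1)
next
  case (3 n)
  have "qint (int n + 2) \<noteq> 0" using qint_Suc_nonzero[of "Suc n"] by (simp add: algebra_simps)
  then show ?case
    using 3 tt_expansion[of "Suc n" l]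
    by (simp add: act_module act_minus qscale_qscale qscale_one algebra_simps)
qed

lemma expansion_even:
  "expansion (2 * m) l = (\<Sum>c=0..m. homog l (2 * m - 2 * c) (coef (2 * m) l (2 * c)))
     + (\<Sum>c\<in>{0..<m}. homog l (2 * m - 1 - 2 * c) (coef (2 * m) l (2 * c + 1)))"
proof -
  have "(\<Sum>d\<le>2 * j. f d) = (\<Sum>c=0..j. f (2 * c)) + (\<Sum>c\<in>{0..<j}. f (2 * c + 1))"
    for f :: "nat \<Rightarrow> Udot" and j
    by (induction j) (simp_all add: algebra_simps)
  then show ?thesis by (simp add: expansion_def)
qed

lemma expansion_odd:
  "expansion (2 * m + 1) l = (\<Sum>c=0..m. homog l (2 * m + 1 - 2 * c) (coef (2 * m + 1) l (2 * c)))
     + (\<Sum>c=0..m. homog l (2 * m - 2 * c) (coef (2 * m + 1) l (2 * c + 1)))"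
proof -
  have split: "(\<Sum>d\<le>2 * j + 1. f d) = (\<Sum>c=0..j. f (2 * c)) + (\<Sum>c=0..j. f (2 * c + 1))"
    for f :: "nat \<Rightarrow> Udot" and j
    by (induction j) (simp_all add: algebra_simps)
  show ?thesis unfolding expansion_def split by simp
qed

section \<open>Integrality\<close>

lemma laurentA_monomial: "of_int z * q powi k \<in> laurentA"
proof -
  have "(\<Sum>j=-\<bar>k\<bar>..\<bar>k\<bar>. of_int (if j = k then z else 0) * q powi j)
      = (\<Sum>j=-\<bar>k\<bar>..\<bar>k\<bar>. if j = k then of_int z * q powi k else 0)"
    by (rule sum.cong) auto
  also have "\<dots> = of_int z * q powi k" by auto
  finally show ?thesis
    unfolding laurentA_def by (intro CollectI exI[of _ "\<lambda>j. if j = k then z else 0"] exI[of _ "\<bar>k\<bar>"]) simp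
qed

lemma laurentA_powi: "q powi k \<in> laurentA"
  using laurentA_monomial[of 1 k] by simp

lemma laurentA_add:
  assumes "x \<in> laurentA" "y \<in> laurentA"
  shows "x + y \<in> laurentA"
proof -
  obtain c N d M where x: "x = (\<Sum>k=-N..N. of_int (c k) * q powi k)"
    and y: "y = (\<Sum>k=-M..M. of_int (d k) * q powi k)"
    using assms unfolding laurentA_def by blast
  \<comment> \<open>Both sums are extended by zero to a common range.\<close>
  have extend: "(\<Sum>k=-N..N. of_int (c k) * q powi k)
      = (\<Sum>k=-R..R. of_int (if \<bar>k\<bar> \<le> N then c k else 0) * q powi k)"
    if "N \<le> R" for N R :: int and c
    by (rule sum.mono_neutral_cong_left) (use that in auto)
  have "x + y = (\<Sum>k=-max N M..max N M. of_int ((if \<bar>k\<bar> \<le> N then c k else 0)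
      + (if \<bar>k\<bar> \<le> M then d k else 0)) * q powi k)"
    unfolding x y extend[of N "max N M" c, simplified] extend[of M "max N M" d, simplified]
    by (simp only: sum.distrib[symmetric] distrib_right of_int_add)
  then show ?thesis unfolding laurentA_def by (intro CollectI exI conjI TrueI)
qed

lemma laurentA_sum: "(\<And>i. i \<in> S \<Longrightarrow> f i \<in> laurentA) \<Longrightarrow> (\<Sum>i\<in>S. f i) \<in> laurentA"
  using laurentA_monomial[of 0 0]
  by (induction S rule: infinite_finite_induct) (auto intro: laurentA_add)

lemma laurentA_mult:
  assumes "x \<in> laurentA" "y \<in> laurentA"
  shows "x * y \<in> laurentA"
proof -
  obtain c N d M where x: "x = (\<Sum>k=-N..N. of_int (c k) * q powi k)"
    and y: "y = (\<Sum>k=-M..M. of_int (d k) * q powi k)"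
    using assms unfolding laurentA_def by blast
  have "(of_int (c i) * q powi i) * (of_int (d j) * q powi j) \<in> laurentA" for i j
    using laurentA_monomial[of "c i * d j" "i + j"] by (simp add: power_int_add mult_ac)
  then show ?thesis unfolding x y sum_product by (intro laurentA_sum)
qed

lemma laurentA_diff: "x \<in> laurentA \<Longrightarrow> y \<in> laurentA \<Longrightarrow> x - y \<in> laurentA"
  using laurentA_add[of x "- y"] laurentA_mult[of "- 1" y] laurentA_monomial[of "- 1" 0] by simp

text \<open>The Pascal rule can be solved for either of the two upper indices, so that integrality spreads
  from the upper index 0 to all integers in both directions.\<close>

lemma qbinom2_laurentA: "qbinom2 p c \<in> laurentA"
proof (induction c arbitrary: p)
  case 0
  show ?case using laurentA_monomial[of 1 0] by simp
next
  case (Suc c)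
  show ?case
  proof (induction p rule: int_induct[where k = 0])
    case base
    show ?case
      using qbinom2_Suc_shift[of "- 1" c] laurentA_monomial[of 0 0] by (simp add: qdiff_def)
  next
    case (step1 i)
    show ?case
      unfolding qbinom2_Pascal by (intro laurentA_add laurentA_mult laurentA_powi Suc.IH step1.IH)
  next
    case (step2 i)
    have "qbinom2 i (Suc c) = q powi (2 * int c + 2) * qbinom2 (i - 1) (Suc c)
        + q powi (- 2 * (i - 1 - int c)) * qbinom2 (i - 1) c"
      using qbinom2_Pascal[of "i - 1" c] by simp
    then have "qbinom2 (i - 1) (Suc c) = q powi (- (2 * int c + 2))
        * (qbinom2 i (Suc c) - q powi (- 2 * (i - 1 - int c)) * qbinom2 (i - 1) c)"
      by (simp add: qpow_mult_left)
    then show ?case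
      by (metis laurentA_mult laurentA_diff laurentA_powi Suc.IH step2.IH)
  qed
qed

lemma coef_laurentA: "coef n l d a \<in> laurentA"
  by (simp add: coef_def Let_def laurentA_mult laurentA_powi qbinom2_laurentA)

lemma pbw_AUdot: "pbw l a b \<in> AUdot"
proof -
  have "idem (2 * l - 2 * int b) * (Fdiv b \<rhd> idem (2 * l)) = Fdiv b \<rhd> idem (2 * l)"
    by (rule Fdiv_weight) (simp add: pgen_dgen_rel)
  then have "pbw l a b = (Ediv a \<rhd> idem (2 * l - 2 * int b)) * (Fdiv b \<rhd> idem (2 * l))"
    by (simp add: pbw_def act_module act_mult_right[symmetric])
  then show ?thesis by (simp add: AUdot.intros)
qed

lemma zero_AUdot: "0 \<in> AUdot"
  using AUdot.intros(6)[OF _ AUdot.intros(1), of 0 0] laurentA_monomial[of 0 0] by simp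

lemma AUdot_sum: "(\<And>i. i \<in> S \<Longrightarrow> f i \<in> AUdot) \<Longrightarrow> (\<Sum>i\<in>S. f i) \<in> AUdot"
  by (induction S rule: infinite_finite_induct) (auto intro: AUdot.intros zero_AUdot)

lemma expansion_AUdot: "expansion n l \<in> AUdot"
  unfolding expansion_def homog_def
  by (intro AUdot_sum AUdot.intros(6) coef_laurentA pbw_AUdot)

lemma t_ev_AUdot_ev: "t_ev n \<rhd> idem (2 * l) \<in> AUdot_ev"
proof -
  let ?x = "t_ev n \<rhd> idem (2 * l)"
  have "?x * idem (2 * l) = ?x"
    by (simp add: act_mult_right[symmetric] pgen_dgen_rel)
  then have "?x = (\<Sum>\<nu>\<in>{l}. ?x * idem (2 * \<nu>))" by simp
  moreover have "?x \<in> AUdot" by (simp add: t_ev_expansion expansion_AUdot)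
  ultimately show ?thesis
    unfolding AUdot_ev_def by (intro CollectI exI[of _ "{l}"] exI[of _ "\<lambda>_. ?x"]) simp
qed

section \<open>The explicit formulas\<close>

theorem proposition4p4:
  shows "(\<forall>(m::nat) (l::int).
      t_ev (2 * m) \<rhd> idem (2 * l) =
        (\<Sum>c=0..m. \<Sum>a=0..2 * m - 2 * c.
           (q powi (2 * (int a + int c) * (int m - int a - l) - 2 * int a * int c
                      - binom_two (2 * int c))
              * qbinom2 (int m - int c - int a - l) c)
             *\<^sub>q ((Ediv a * Fdiv (2 * m - 2 * c - a)) \<rhd> idem (2 * l)))
      + (\<Sum>c\<in>{0..<m}. \<Sum>a=0..2 * m - 1 - 2 * c.
           (q powi (2 * (int a + int c + 1) * (int m - int a - l) - 2 * int a * int c - int a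
                      - binom_two (2 * int c + 2))
              * qbinom2 (int m - int c - int a - l - 1) c)
             *\<^sub>q ((Ediv a * Fdiv (2 * m - 1 - 2 * c - a)) \<rhd> idem (2 * l))))
    \<and> (\<forall>(m::nat) (l::int).
      t_ev (2 * m + 1) \<rhd> idem (2 * l) =
        (\<Sum>c=0..m. \<Sum>a=0..2 * m + 1 - 2 * c.
           (q powi (2 * (int a + int c) * (int m - int a - l) - 2 * int a * int c + int a
                      - binom_two (2 * int c))
              * qbinom2 (int m - int c - int a - l + 1) c)
             *\<^sub>q ((Ediv a * Fdiv (2 * m + 1 - 2 * c - a)) \<rhd> idem (2 * l)))
      + (\<Sum>c=0..m. \<Sum>a=0..2 * m - 2 * c.
           (q powi (2 * (int a + int c + 1) * (int m - int a - l) - 2 * int a * int c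
                      - binom_two (2 * int c + 2) + 1)
              * qbinom2 (int m - int c - int a - l) c)
             *\<^sub>q ((Ediv a * Fdiv (2 * m - 2 * c - a)) \<rhd> idem (2 * l))))
    \<and> (\<forall>(n::nat) (l::int). t_ev n \<rhd> idem (2 * l) \<in> AUdot_ev)"
proof (intro conjI allI t_ev_AUdot_ev)
  fix m :: nat and l :: int
  show "t_ev (2 * m) \<rhd> idem (2 * l) =
        (\<Sum>c=0..m. \<Sum>a=0..2 * m - 2 * c.
           (q powi (2 * (int a + int c) * (int m - int a - l) - 2 * int a * int c
                      - binom_two (2 * int c))
              * qbinom2 (int m - int c - int a - l) c)
             *\<^sub>q ((Ediv a * Fdiv (2 * m - 2 * c - a)) \<rhd> idem (2 * l)))
      + (\<Sum>c\<in>{0..<m}. \<Sum>a=0..2 * m - 1 - 2 * c.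
           (q powi (2 * (int a + int c + 1) * (int m - int a - l) - 2 * int a * int c - int a
                      - binom_two (2 * int c + 2))
              * qbinom2 (int m - int c - int a - l - 1) c)
             *\<^sub>q ((Ediv a * Fdiv (2 * m - 1 - 2 * c - a)) \<rhd> idem (2 * l)))"
    unfolding t_ev_expansion expansion_even homog_def coef_simps pbw_def binom_two_even
      binom_two_even_plus_2 atLeast0AtMost by (rule refl)
  show "t_ev (2 * m + 1) \<rhd> idem (2 * l) =
        (\<Sum>c=0..m. \<Sum>a=0..2 * m + 1 - 2 * c.
           (q powi (2 * (int a + int c) * (int m - int a - l) - 2 * int a * int c + int a
                      - binom_two (2 * int c))
              * qbinom2 (int m - int c - int a - l + 1) c)
             *\<^sub>q ((Ediv a * Fdiv (2 * m + 1 - 2 * c - a)) \<rhd> idem (2 * l)))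
      + (\<Sum>c=0..m. \<Sum>a=0..2 * m - 2 * c.
           (q powi (2 * (int a + int c + 1) * (int m - int a - l) - 2 * int a * int c
                      - binom_two (2 * int c + 2) + 1)
              * qbinom2 (int m - int c - int a - l) c)
             *\<^sub>q ((Ediv a * Fdiv (2 * m - 2 * c - a)) \<rhd> idem (2 * l)))"
    unfolding t_ev_expansion expansion_odd homog_def coef_simps pbw_def binom_two_even
      binom_two_even_plus_2 atLeast0AtMost by (rule refl)
qed

end
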